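(* Let $n\ge 1$, $r\ge 0$. The bijection $\mathcal{M}$ between $n$-symplectic oscillating tableaux of empty shape and length $r$ and $(n+1)$-noncrossing perfect matchings of $\{1,\dots,r\}$ intertwines promotion and rotation, and evacuation and reversal: for every $n$-symplectic oscillating tableau $\mathcal{O}$ of empty shape and length $r$, $$\mathrm{rot}\,\mathcal{M}(\mathcal{O})=\mathcal{M}(\mathrm{pr}\,\mathcal{O})\quad\text{and}\quad \mathrm{rev}\,\mathcal{M}(\mathcal{O})=\mathcal{M}(\mathrm{ev}\,\mathcal{O}).$$
   Context: **Oscillating tableaux.** An $n$-symplectic oscillating tableau of length $r$ and shape $\mu$ is a sequence of partitions $\mathcal{O}=(\emptyset=\omega^0,\omega^1,\dots,\omega^r=\mu)$ such that the Ferrers diagrams of consecutive partitions differ by exactly one cell and each $\omega^i$ has at most $n$ nonzero parts. It is of empty shape if $\mu=\emptyset$. Partitions with at most $n$ parts are regarded as vectors in $\mathbb{Z}^n$ (padded with zeros). **Promotion and evacuation.** Oscillating tableaux correspond to highest weight words in the $r$-th tensor power of the crystal of the vector representation of $\mathrm{Sp}(2n)$ (the $i$-th letter has weight $\omega^i-\omega^{i-1}$); promotion $\mathrm{pr}$ and evacuation $\mathrm{ev}$ are the actions of the elements $s_{1,r}s_{2,r}$ and $s_{1,r}$ of the cactus group on these words. Explicitly (this may be taken as the definition): for $v\in\mathbb{Z}^n$ let $\mathrm{dom}(v)$ be the vector obtained by sorting the absolute values of the entries of $v$ into weakly decreasing order. For $r\ge1$, $\mathrm{pr}\,\mathcal{O}=(\hat\omega^0,\dots,\hat\omega^r)$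 with $\hat\omega^0=\emptyset$, $\hat\omega^{i-1}=\mathrm{dom}(\hat\omega^{i-2}+\omega^i-\omega^{i-1})$ for $2\le i\le r$, and $\hat\omega^r=\omega^r$. For evacuation, define $T_{k,j}$ for $0\le k\le j\le r$ by $T_{0,j}=\omega^j$, $T_{k,k}=\emptyset$, and $T_{k+1,j}=\mathrm{dom}(T_{k+1,j-1}+T_{k,j}-T_{k,j-1})$ for $j\ge k+2$. Then the $i$-th partition of $\mathrm{ev}\,\mathcal{O}$ is $T_{r-i,r}$, $0\le i\le r$. **Backward rule of growth diagrams.** Consider a square cell whose corners top-left, top-right, bottom-right are labelled with partitions $\kappa$, $\mu$, $\nu$, where $\mu$ equals or is obtained by adding one cell from each of $\kappa$, $\nu$. If $\kappa=\nu$ and $\mu=\kappa+e_1$ (a cell added to the first row), then the cell contains a cross and the bottom-left corner gets the label $\lambda=\kappa$. Otherwise the cell is empty and the bottom-left label $\lambda$ is determined by $\lambda'=\mathrm{sort}(\kappa'+\nu'-\mu')$, where $'$ denotes conjugation of partitions and $\mathrm{sort}$ sorts a vector into weakly decreasing order. **Sundaram's map (in Roby's form).** Consider corners $(a,b)$ with integers $0\le a\le b\le r$, where $a$ is the horizontal coordinate (increasing to the right) and $b$ the vertical coordinate (increasing downwards). The cell in column $i$ and row $j$ ($1\le i<j\le r$) has corners $(i-1,j-1),(i,j-1),(i-1,j),(i,j)$. Label $(i,i)$ with $\omega^i$ for $0\le i\le r$, and label $(i-1,i)$ with the smaller of $\omega^{i-1},\omega^i$ for $1\le i\le r$. Apply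 the backward rule successively to determine all remaining labels and all crosses. $\mathcal{M}(\mathcal{O})$ is the set of pairs $\{i,j\}$ such that the cell in column $i$ and row $j$ contains a cross. It is known (Sundaram, Roby) that $\mathcal{M}$ is a bijection from $n$-symplectic oscillating tableaux of empty shape and length $r$ to $(n+1)$-noncrossing perfect matchings of $\{1,\dots,r\}$. **Matchings.** Pairs $(i,j)$, $(k,l)$ with $i<j$, $k<l$ cross if $i<k<j<l$ or $k<i<l<j$. A perfect matching is $(n+1)$-noncrossing if it contains at most $n$ mutually crossing pairs. The reversal $\mathrm{rev}\,m$ replaces each pair $(i,j)$ of $m$ by $(r+1-j,r+1-i)$. The rotation $\mathrm{rot}\,m$ replaces each pair $(i,j)$ by the pair $\big((i\bmod r)+1,(j\bmod r)+1\big)$.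
   Formalization: With the explicit pr, rot M(O) = M(pr O) is false: for n=1, O=(0,1,2,3,2,1,0), rot M(O)={12,36,45} but M(pr O)={14,23,56}. It is replaced by rot M(pr O) = M(O), i.e. promotion corresponds to inverse rotation; the evacuation identity is unchanged. *)

theory Defs
  imports Main
begin

text \<open>Partitions with at most n parts are integer vectors of length n, padded with zeros;
  list index 0 is the first part.\<close>

definition is_partition :: "nat \<Rightarrow> int list \<Rightarrow> bool" where
  "is_partition n v \<longleftrightarrow> length v = n \<and> (\<forall>x\<in>set v. 0 \<le> x) \<and> sorted_wrt (\<ge>) v"

definition empty_partition :: "nat \<Rightarrow> int list" where
  "empty_partition n = replicate n 0"

definition add_cell :: "nat \<Rightarrow> int list \<Rightarrow> int list" where
  "add_cell k v = v[k := v ! k + 1]"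

definition differ_by_cell :: "int list \<Rightarrow> int list \<Rightarrow> bool" where
  "differ_by_cell v w \<longleftrightarrow>
     (\<exists>k<length v. w = add_cell k v) \<or> (\<exists>k<length w. v = add_cell k w)"

definition osc_tableau :: "nat \<Rightarrow> nat \<Rightarrow> int list \<Rightarrow> int list list \<Rightarrow> bool" where
  "osc_tableau n r \<mu> \<omega> \<longleftrightarrow>
     length \<omega> = r + 1 \<and>
     (\<forall>i\<le>r. is_partition n (\<omega> ! i)) \<and>
     \<omega> ! 0 = empty_partition n \<and> \<omega> ! r = \<mu> \<and>
     (\<forall>i<r. differ_by_cell (\<omega> ! i) (\<omega> ! Suc i))"

definition vadd :: "int list \<Rightarrow> int list \<Rightarrow> int list" where
  "vadd = map2 (+)"

definition vsub :: "int list \<Rightarrow> int list \<Rightarrow> int list" where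
  "vsub = map2 (-)"

definition sort_desc :: "int list \<Rightarrow> int list" where
  "sort_desc v = rev (sort v)"

definition dominant :: "int list \<Rightarrow> int list" where
  "dominant v = sort_desc (map abs v)"

text \<open>The entries of index below r of the promotion; the last entry is kept fixed.
  For r = 0 this makes promotion the identity.\<close>

fun promotion_entry :: "nat \<Rightarrow> int list list \<Rightarrow> nat \<Rightarrow> int list" where
  "promotion_entry n \<omega> 0 = empty_partition n"
| "promotion_entry n \<omega> (Suc k) =
     dominant (vsub (vadd (promotion_entry n \<omega> k) (\<omega> ! (k + 2))) (\<omega> ! (k + 1)))"

definition promotion :: "nat \<Rightarrow> nat \<Rightarrow> int list list \<Rightarrow> int list list" where
  "promotion n r \<omega> = map (promotion_entry n \<omega>) [0..<r] @ [\<omega> ! r]"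

text \<open>Only the entries with \<open>k \<le> j\<close> of the triangular array are meaningful.\<close>

fun evac_entry :: "nat \<Rightarrow> int list list \<Rightarrow> nat \<Rightarrow> nat \<Rightarrow> int list" where
  "evac_entry n \<omega> 0 j = \<omega> ! j"
| "evac_entry n \<omega> (Suc k) 0 = empty_partition n"
| "evac_entry n \<omega> (Suc k) (Suc j) =
     (if j \<le> k then empty_partition n
      else dominant (vsub (vadd (evac_entry n \<omega> (Suc k) j) (evac_entry n \<omega> k (Suc j)))
                          (evac_entry n \<omega> k j)))"

definition evacuation :: "nat \<Rightarrow> nat \<Rightarrow> int list list \<Rightarrow> int list list" where
  "evacuation n r \<omega> = map (\<lambda>i. evac_entry n \<omega> (r - i) r) [0..<r + 1]"

text \<open>The conjugate of a partition, as a vector of length m (m at least the largest part).\<close>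

definition conjugate :: "nat \<Rightarrow> int list \<Rightarrow> int list" where
  "conjugate m v = map (\<lambda>j. int (length (filter (\<lambda>x. int j < x) v))) [0..<m]"

lemma conjugate_conjugate:
  assumes "is_partition m w" and "\<forall>x\<in>set w. x \<le> int n"
  shows "conjugate m (conjugate n w) = w"
proof (rule nth_equalityI)
  have len: "length w = m" using assms(1) by (simp add: is_partition_def)
  then show "length (conjugate m (conjugate n w)) = length w"
    by (simp add: conjugate_def)
  fix j assume "j < length (conjugate m (conjugate n w))"
  then have j: "j < m" by (simp add: conjugate_def)
  have mono: "w ! b \<le> w ! a" if "a \<le> b" "b < m" for a b
    using assms(1) that len
    by (cases "a = b") (auto simp: is_partition_def sorted_wrt_iff_nth_less)
  have wj: "0 \<le> w ! j" "w ! j \<le> int n"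
    using assms j len by (auto simp: is_partition_def)
  have cnt: "j < length (filter (\<lambda>x. int i < x) w) \<longleftrightarrow> int i < w ! j" for i
  proof
    assume less: "int i < w ! j"
    have "{..j} \<subseteq> {k. k < length w \<and> int i < w ! k}"
    proof
      fix k assume "k \<in> {..j}"
      then show "k \<in> {k. k < length w \<and> int i < w ! k}"
        using mono[of k j] less j len by simp
    qed
    then have "card {..j} \<le> card {k. k < length w \<and> int i < w ! k}"
      by (intro card_mono) auto
    then show "j < length (filter (\<lambda>x. int i < x) w)"
      by (simp add: length_filter_conv_card)
  next
    assume less: "j < length (filter (\<lambda>x. int i < x) w)"
    show "int i < w ! j"
    proof (rule ccontr)
      assume neg: "\<not> int i < w ! j"
      have "{k. k < length w \<and> int i < w ! k} \<subseteq> {..<j}"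
      proof
        fix k assume k: "k \<in> {k. k < length w \<and> int i < w ! k}"
        show "k \<in> {..<j}"
        proof (rule ccontr)
          assume "k \<notin> {..<j}"
          then have "w ! k \<le> w ! j" using mono[of j k] k len by auto
          then show False using k neg by auto
        qed
      qed
      then have "card {k. k < length w \<and> int i < w ! k} \<le> card {..<j}"
        by (intro card_mono) auto
      then show False using less by (simp add: length_filter_conv_card)
    qed
  qed
  have "conjugate m (conjugate n w) ! j = int (card {i. i < n \<and> int i < w ! j})"
  proof -
    have "conjugate m (conjugate n w) ! j
        = int (length (filter (\<lambda>x. int j < x) (conjugate n w)))"
      using j by (simp add: conjugate_def)
    also have "length (filter (\<lambda>x. int j < x) (conjugate n w))
        = card {i. i < n \<and> int j < conjugate n w ! i}"
      by (simp add: length_filter_conv_card conjugate_def)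
    also have "{i. i < n \<and> int j < conjugate n w ! i} = {i. i < n \<and> int i < w ! j}"
    proof -
      have "int j < conjugate n w ! i \<longleftrightarrow> int i < w ! j" if "i < n" for i
        using cnt[of i] that by (simp add: conjugate_def)
      then show ?thesis by blast
    qed
    finally show ?thesis .
  qed
  also have "{i. i < n \<and> int i < w ! j} = {..<nat (w ! j)}"
    using wj by auto
  finally show "conjugate m (conjugate n w) ! j = w ! j" using wj by simp
qed

text \<open>Backward rule for a cell with top-left \<open>\<kappa>\<close>, top-right \<open>\<mu>\<close>, bottom-right \<open>\<nu>\<close>.
  Since \<open>\<kappa>\<close> and \<open>\<nu>\<close> are contained in \<open>\<mu>\<close>, all conjugates are vectors of length \<open>\<mu> ! 0\<close>;
  by \<open>conjugate_conjugate\<close> the label \<open>\<lambda>\<close> of an empty cell is the one whose conjugate is the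
  sorted vector.\<close>

definition has_cross :: "int list \<Rightarrow> int list \<Rightarrow> int list \<Rightarrow> bool" where
  "has_cross \<kappa> \<mu> \<nu> \<longleftrightarrow> \<kappa> = \<nu> \<and> \<mu> = add_cell 0 \<kappa>"

definition backward_rule :: "int list \<Rightarrow> int list \<Rightarrow> int list \<Rightarrow> int list" where
  "backward_rule \<kappa> \<mu> \<nu> =
     (if has_cross \<kappa> \<mu> \<nu> then \<kappa>
      else let m = nat (\<mu> ! 0) in
        conjugate (length \<mu>)
          (sort_desc (vsub (vadd (conjugate m \<kappa>) (conjugate m \<nu>)) (conjugate m \<mu>))))"

definition smaller :: "int list \<Rightarrow> int list \<Rightarrow> int list" where
  "smaller v w = (if list_all2 (\<le>) v w then v else w)"

text \<open>The label of corner \<open>(a, b)\<close>, a horizontal (to the right), b vertical (downwards);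
  only \<open>a \<le> b\<close> is meaningful.\<close>

function corner_label :: "int list list \<Rightarrow> nat \<Rightarrow> nat \<Rightarrow> int list" where
  "corner_label \<omega> a b =
     (if b \<le> a then \<omega> ! a
      else if b = Suc a then smaller (\<omega> ! a) (\<omega> ! b)
      else backward_rule (corner_label \<omega> a (b - 1))
                         (corner_label \<omega> (Suc a) (b - 1))
                         (corner_label \<omega> (Suc a) b))"
  by auto
termination by (relation "measure (\<lambda>(\<omega>, a, b). b - a)") auto

declare corner_label.simps [simp del]

definition cell_cross :: "int list list \<Rightarrow> nat \<Rightarrow> nat \<Rightarrow> bool" where
  "cell_cross \<omega> i j \<longleftrightarrow>
     has_cross (corner_label \<omega> (i - 1) (j - 1)) (corner_label \<omega> i (j - 1)) (corner_label \<omega> i j)"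

definition sundaram :: "nat \<Rightarrow> int list list \<Rightarrow> nat set set" where
  "sundaram r \<omega> = {{i, j} | i j. 1 \<le> i \<and> i < j \<and> j \<le> r \<and> cell_cross \<omega> i j}"

text \<open>A matching of \<open>{1..r}\<close> is the set of its pairs, each pair being a two-element set.\<close>

definition rotate_matching :: "nat \<Rightarrow> nat set set \<Rightarrow> nat set set" where
  "rotate_matching r m = (\<lambda>p. (\<lambda>i. i mod r + 1) ` p) ` m"

definition reverse_matching :: "nat \<Rightarrow> nat set set \<Rightarrow> nat set set" where
  "reverse_matching r m = (\<lambda>p. (\<lambda>i. r + 1 - i) ` p) ` m"

text \<open>Orientation. Promotion as defined here drops the first step of the tableau and appends one
  at the end, so it moves the pairs of the matching one position to the left (cyclically), whereas
  the rotation moves them one position to the right. The two are therefore intertwined up to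
  inversion, that is, \<open>rot (M (pr \<omega>)) = M \<omega>\<close>. The identity \<open>rot (M \<omega>) = M (pr \<omega>)\<close>
  fails for the following tableau, whose matching is 16, 25, 34: its promotion is
  0, 1, 2, 1, 0, 1, 0, with matching 14, 23, 56, while the rotated matching is 12, 36, 45.\<close>

lemma rotation_not_promotion:
  defines "\<omega> \<equiv> [[0], [1], [2], [3], [2], [1], [0::int]]"
  shows "osc_tableau 1 6 (empty_partition 1) \<omega>"
    and "rotate_matching 6 (sundaram 6 \<omega>) \<noteq> sundaram 6 (promotion 1 6 \<omega>)"
proof -
  have "\<forall>i<6. differ_by_cell (\<omega> ! i) (\<omega> ! Suc i)"
    by (simp add: \<omega>_def differ_by_cell_def add_cell_def All_less_Suc numeral_eq_Suc)
  moreover have "\<forall>i\<le>6. is_partition 1 (\<omega> ! i)"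
    by (simp add: \<omega>_def is_partition_def le_Suc_eq numeral_eq_Suc all_conj_distrib)
  ultimately show "osc_tableau 1 6 (empty_partition 1) \<omega>"
    by (simp add: osc_tableau_def \<omega>_def empty_partition_def)
  have cross: "cell_cross \<omega> 1 6" unfolding \<omega>_def by code_simp
  have empty: "\<not> cell_cross (promotion 1 6 \<omega>) 1 2" unfolding \<omega>_def by code_simp
  have "{1, 6} \<in> sundaram 6 \<omega>"
    using cross unfolding sundaram_def by (intro CollectI exI[of _ 1] exI[of _ 6]) auto
  then have "{2, 1} \<in> rotate_matching 6 (sundaram 6 \<omega>)"
    unfolding rotate_matching_def by (rule rev_image_eqI) (simp add: numeral_2_eq_2)
  moreover have "{2, 1} \<notin> sundaram 6 (promotion 1 6 \<omega>)"
  proof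
    assume "{2, 1} \<in> sundaram 6 (promotion 1 6 \<omega>)"
    then obtain i j where "{2, 1} = {i, j}" "i < j" "cell_cross (promotion 1 6 \<omega>) i j"
      by (auto simp: sundaram_def)
    moreover from this have "i = 1 \<and> j = 2" by (auto simp: doubleton_eq_iff)
    ultimately show False using empty by simp
  qed
  ultimately show "rotate_matching 6 (sundaram 6 \<omega>) \<noteq> sundaram 6 (promotion 1 6 \<omega>)"
    by metis
qed

end

theory Submission
  imports Defs "HOL-Library.Multiset"
begin

text \<open>Both intertwining properties are read off the triangular array \<open>T\<close> of evacuation,
whose rows are initial parts of the iterated promotions. In each unit square, with corners
\<open>A = T k (j - 1)\<close>, \<open>B = T k j\<close>, \<open>C = T (k + 1) (j - 1)\<close>,
\<open>D = T (k + 1) j\<close>, the rule \<open>D = dominant (B + C - A)\<close> takes one of a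
few combinatorial forms, all of which are invariant under exchanging \<open>A\<close> and
\<open>D\<close>. In exactly one of these forms an entry of \<open>B + C - A\<close> is
negative: then \<open>B = C\<close> and \<open>A = D\<close> is \<open>B\<close> with a new row
of length one. Call such a square a fold.

The heart of the proof is that cell \<open>(i, j)\<close> of the growth diagram contains a
cross if and only if the square with bottom-right corner \<open>T i j\<close> is a fold
(\<open>cell_cross_iff_evac_fold\<close>). Reflecting the array at its antidiagonal yields the
array of the evacuation and preserves folds, so evacuation reverses the matching. Deleting the
first row yields the array of the promotion up to its last column, so promotion shifts all
pairs that avoid the point 1; the partner of 1 is recognised by the shapes in the last row of
the growth diagram.

Crosses and folds are compared by deleting one row of \<open>T\<close> at a time. The label of
corner \<open>(a, b)\<close> should be thought of as the Robinson-Schensted shape of the pairs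
\<open>{p, q}\<close> with \<open>p \<le> a\<close> and \<open>b < q\<close>, and a promotion
as moving the point 1 behind the last point. If 1 is matched with \<open>c\<close>, this takes
one cell from the shapes with \<open>b < c\<close>, adds one cell to the shapes with \<open>c
\<le> a\<close>, and changes nothing for \<open>a < c \<le> b\<close>. In terms of labels, the
two diagrams are placed above each other, which turns every cell into a cube. Two faces of the
cube obey the backward rule; of the vertical faces, one pair obeys the rule of jeu de taquin
and the other pair the rule of column insertion, and these are just the two kinds of unfolded
squares in the array. The lemma \<open>backward_cube\<close> says that the backward rule
transports these conditions from the two faces at the top right of a cell to the two faces at
its bottom left, and that the two cells have the same crosses; \<open>backward_fold\<close>
does this across the lines \<open>b = c\<close> and \<open>a = c\<close>. On the diagonal the
conditions hold by the local rule.\<close>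

section \<open>Cells of partitions\<close>

text \<open>All shapes that meet in a cell or a cube arise from the largest one by deleting cells, so that
configurations are described by the rows of the deleted cells.\<close>

definition remove_cell :: "nat \<Rightarrow> int list \<Rightarrow> int list" where
  "remove_cell k v = v[k := v ! k - 1]"

lemma length_remove_cell [simp]: "length (remove_cell k v) = length v"
  by (simp add: remove_cell_def)

lemma length_add_cell [simp]: "length (add_cell k v) = length v"
  by (simp add: add_cell_def)

lemma nth_remove_cell:
  "i < length v \<Longrightarrow> remove_cell k v ! i = v ! i - (if i = k then 1 else 0)"
  by (simp add: remove_cell_def nth_list_update)

lemma nth_add_cell:
  "i < length v \<Longrightarrow> add_cell k v ! i = v ! i + (if i = k then 1 else 0)"
  by (simp add: add_cell_def nth_list_update)

lemma add_remove_cell [simp]: "add_cell k (remove_cell k v) = v"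
  by (rule nth_equalityI) (simp_all add: nth_add_cell nth_remove_cell)

lemma remove_add_cell [simp]: "remove_cell k (add_cell k v) = v"
  by (rule nth_equalityI) (simp_all add: nth_add_cell nth_remove_cell)

lemma remove_cell_commute: "remove_cell x (remove_cell y v) = remove_cell y (remove_cell x v)"
  by (rule nth_equalityI) (simp_all add: nth_remove_cell)

lemma remove_cell_eq_iff [simp]:
  assumes "x < length v"
  shows "remove_cell x v = remove_cell y v \<longleftrightarrow> x = y"
proof
  assume "remove_cell x v = remove_cell y v"
  then have "remove_cell x v ! x = remove_cell y v ! x" by simp
  then show "x = y" using assms by (simp add: nth_remove_cell split: if_splits)
qed simp

lemma remove_cell_neq [simp]:
  assumes "x < length v"
  shows "remove_cell x v \<noteq> v" "v \<noteq> remove_cell x v"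
  using assms nth_remove_cell[of x v x] by auto

lemma add_cell_eq_iff: "w = add_cell x v \<longleftrightarrow> v = remove_cell x w"
  by auto

lemma is_partition_iff:
  "is_partition n v \<longleftrightarrow>
     length v = n \<and> (\<forall>i<n. 0 \<le> v ! i) \<and> (\<forall>i. Suc i < n \<longrightarrow> v ! Suc i \<le> v ! i)"
proof -
  have "transp ((\<ge>) :: int \<Rightarrow> int \<Rightarrow> bool)" by (auto simp: transp_def)
  then show ?thesis
    by (auto simp: is_partition_def all_set_conv_all_nth sorted_wrt_iff_nth_Suc_transp)
qed

lemma partition_length: "is_partition n v \<Longrightarrow> length v = n"
  by (simp add: is_partition_def)

lemma partition_nonneg: "is_partition n v \<Longrightarrow> i < n \<Longrightarrow> 0 \<le> v ! i"
  by (simp add: is_partition_iff)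

lemma partition_mono: "is_partition n v \<Longrightarrow> i \<le> j \<Longrightarrow> j < n \<Longrightarrow> v ! j \<le> v ! i"
  by (cases "i = j") (auto simp: is_partition_def sorted_wrt_iff_nth_less)

lemma is_partition_empty: "is_partition n (empty_partition n)"
  by (simp add: is_partition_iff empty_partition_def)

lemma partition_remove_cell:
  assumes "is_partition n v" "x < n"
  shows "is_partition n (remove_cell x v) \<longleftrightarrow>
    0 < v ! x \<and> (Suc x < n \<longrightarrow> v ! Suc x < v ! x)"
proof
  assume p: "is_partition n (remove_cell x v)"
  show "0 < v ! x \<and> (Suc x < n \<longrightarrow> v ! Suc x < v ! x)"
    using partition_nonneg[OF p, of x] partition_mono[OF p, of x "Suc x"] assms
    by (auto simp: nth_remove_cell partition_length)
next
  assume "0 < v ! x \<and> (Suc x < n \<longrightarrow> v ! Suc x < v ! x)"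
  then show "is_partition n (remove_cell x v)"
    using assms unfolding is_partition_iff by (auto simp: nth_remove_cell)
qed

lemma partition_add_cell:
  assumes "is_partition n v" "x < n"
  shows "is_partition n (add_cell x v) \<longleftrightarrow> (0 < x \<longrightarrow> v ! x < v ! (x - 1))"
proof
  assume p: "is_partition n (add_cell x v)"
  show "0 < x \<longrightarrow> v ! x < v ! (x - 1)"
    using partition_mono[OF p, of "x - 1" x] assms
    by (cases x) (auto simp: nth_add_cell partition_length)
next
  assume *: "0 < x \<longrightarrow> v ! x < v ! (x - 1)"
  show "is_partition n (add_cell x v)"
    using assms * unfolding is_partition_iff by (auto simp: nth_add_cell)
qed

lemma partition_remove_two:
  assumes "is_partition n v" "x < n" "y < n" "x \<noteq> y"
    and "is_partition n (remove_cell x v)" "is_partition n (remove_cell y v)"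
  shows "is_partition n (remove_cell y (remove_cell x v))"
  using assms by (auto simp: partition_remove_cell nth_remove_cell partition_length)

text \<open>The covering relation of Young's lattice.\<close>

definition covered :: "int list \<Rightarrow> int list \<Rightarrow> bool" where
  "covered \<kappa> \<mu> \<longleftrightarrow> (\<exists>k<length \<mu>. \<kappa> = remove_cell k \<mu>)"

lemma covered_length: "covered \<kappa> \<mu> \<Longrightarrow> length \<kappa> = length \<mu>"
  by (auto simp: covered_def)

lemma covered_irrefl: "\<not> covered \<kappa> \<kappa>"
  by (auto simp: covered_def)

lemma covered_nth_le: "covered v w \<Longrightarrow> i < length w \<Longrightarrow> v ! i \<le> w ! i"
  by (auto simp: covered_def nth_remove_cell)

lemma covered_nth_less: "covered v w \<Longrightarrow> \<exists>k<length w. v ! k < w ! k"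
  by (auto simp: covered_def nth_remove_cell)

lemma covered_asym: "covered v w \<Longrightarrow> \<not> covered w v"
  using covered_nth_less[of v w] covered_nth_le[of w v] covered_length[of w v] by force

lemma covered_empty:
  assumes "is_partition n v" "covered (empty_partition n) v"
  shows "v = add_cell 0 (empty_partition n)"
proof -
  obtain k where k: "k < n" "empty_partition n = remove_cell k v"
    using assms partition_length by (auto simp: covered_def)
  then have v: "v = add_cell k (empty_partition n)" by simp
  have "k = 0"
    using partition_add_cell[OF is_partition_empty k(1)] assms(1) k(1) unfolding v
    by (auto simp: empty_partition_def)
  then show ?thesis using v by simp
qed

definition weakly_covered :: "int list \<Rightarrow> int list \<Rightarrow> bool" where
  "weakly_covered \<kappa> \<mu> \<longleftrightarrow> \<kappa> = \<mu> \<or> covered \<kappa> \<mu>"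

lemma weakly_covered_empty:
  assumes "is_partition n v" "weakly_covered v (empty_partition n)"
  shows "v = empty_partition n"
proof (rule ccontr)
  assume "v \<noteq> empty_partition n"
  then obtain k where "k < n" "v = remove_cell k (empty_partition n)"
    using assms by (auto simp: weakly_covered_def covered_def empty_partition_def)
  then have "v ! k = - 1" by (simp add: nth_remove_cell empty_partition_def)
  then show False using partition_nonneg[OF assms(1) \<open>k < n\<close>] by simp
qed

lemma smaller_covered:
  assumes "covered v w"
  shows "smaller v w = v" "smaller w v = v"
proof -
  have len: "length v = length w" using covered_length[OF assms] .
  then have "list_all2 (\<le>) v w"
    using covered_nth_le[OF assms] by (simp add: list_all2_conv_all_nth)
  then show "smaller v w = v" by (simp add: smaller_def)
  obtain k where "k < length w" "v ! k < w ! k" using covered_nth_less[OF assms] by blast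
  then have "\<not> list_all2 (\<le>) w v"
    using list_all2_nthD by fastforce
  then show "smaller w v = v" by (simp add: smaller_def)
qed

lemma differ_by_cell_iff: "differ_by_cell v w \<longleftrightarrow> covered v w \<or> covered w v"
  by (auto simp: differ_by_cell_def covered_def add_cell_eq_iff)

lemma differ_by_cell_sym: "differ_by_cell v w \<longleftrightarrow> differ_by_cell w v"
  by (auto simp: differ_by_cell_iff)

section \<open>The backward rule in terms of rows\<close>

lemma sort_desc_eqI:
  assumes "mset v = mset w" "sorted_wrt (\<ge>) w"
  shows "sort_desc v = w"
proof -
  have "sort v = rev w"
    using assms by (intro properties_for_sort) (auto simp: sorted_wrt_rev)
  then show ?thesis by (simp add: sort_desc_def)
qed

lemma length_conjugate [simp]: "length (conjugate m v) = m"
  by (simp add: conjugate_def)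

lemma nth_conjugate:
  "j < m \<Longrightarrow> conjugate m v ! j = int (card {i. i < length v \<and> int j < v ! i})"
  by (simp add: conjugate_def length_filter_conv_card)

lemma sorted_conjugate: "sorted_wrt (\<ge>) (conjugate m v)"
  unfolding sorted_wrt_iff_nth_less
  by (auto simp: nth_conjugate intro!: card_mono)

lemma nth_conjugate_remove_cell:
  assumes "x < length v" "j < m"
  shows "conjugate m (remove_cell x v) ! j
    = conjugate m v ! j - (if v ! x = int j + 1 then 1 else 0)"
proof (cases "v ! x = int j + 1")
  case True
  have "{i. i < length v \<and> int j < v ! i}
      = insert x {i. i < length v \<and> int j < remove_cell x v ! i}"
    using True assms by (auto simp: nth_remove_cell split: if_splits)
  moreover have "x \<notin> {i. i < length v \<and> int j < remove_cell x v ! i}"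
    using True assms by (simp add: nth_remove_cell)
  ultimately show ?thesis using True assms by (simp add: nth_conjugate)
next
  case False
  then have "{i. i < length v \<and> int j < v ! i}
      = {i. i < length v \<and> int j < remove_cell x v ! i}"
    by (auto simp: nth_remove_cell split: if_splits)
  then show ?thesis using False assms by (simp add: nth_conjugate)
qed

lemma length_vadd [simp]: "length (vadd v w) = min (length v) (length w)"
  by (simp add: vadd_def)

lemma length_vsub [simp]: "length (vsub v w) = min (length v) (length w)"
  by (simp add: vsub_def)

lemma nth_vadd: "i < length v \<Longrightarrow> i < length w \<Longrightarrow> vadd v w ! i = v ! i + w ! i"
  by (simp add: vadd_def)

lemma nth_vsub: "i < length v \<Longrightarrow> i < length w \<Longrightarrow> vsub v w ! i = v ! i - w ! i"
  by (simp add: vsub_def)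

lemma vadd_commute: "vadd v w = vadd w v"
  by (rule nth_equalityI) (simp_all add: nth_vadd)

text \<open>The vectors to be sorted here differ from their sorted form by at most one exchange of entries.\<close>

lemma mset_swap_values:
  assumes "length v = length w" "p < length v" "q < length v"
    and "v ! p = w ! q" "v ! q = w ! p"
    and "\<And>i. i < length v \<Longrightarrow> i \<noteq> p \<Longrightarrow> i \<noteq> q \<Longrightarrow> v ! i = w ! i"
  shows "mset v = mset w"
proof -
  have "v = w[p := w ! q, q := w ! p]"
    using assms by (intro nth_equalityI) (auto simp: nth_list_update)
  then show ?thesis using mset_swap[of q w p] assms by simp
qed

lemma backward_rule_commute: "backward_rule \<kappa> \<mu> \<nu> = backward_rule \<nu> \<mu> \<kappa>"
  by (auto simp: backward_rule_def has_cross_def vadd_commute)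

lemma has_cross_commute: "has_cross \<kappa> \<mu> \<nu> = has_cross \<nu> \<mu> \<kappa>"
  by (auto simp: has_cross_def)

text \<open>Conjugation is involutive on partitions inside the box of \<open>\<mu>\<close>, so it suffices
to recognise the sorted vector as a rearrangement of the conjugate of \<open>\<rho>\<close>.\<close>

lemma backward_rule_eqI:
  assumes "is_partition n \<mu>" "is_partition n \<rho>" "\<And>i. i < n \<Longrightarrow> \<rho> ! i \<le> \<mu> ! i"
    and "\<not> has_cross \<kappa> \<mu> \<nu>"
    and "mset (vsub (vadd (conjugate (nat (\<mu> ! 0)) \<kappa>) (conjugate (nat (\<mu> ! 0)) \<nu>))
               (conjugate (nat (\<mu> ! 0)) \<mu>)) = mset (conjugate (nat (\<mu> ! 0)) \<rho>)"
  shows "backward_rule \<kappa> \<mu> \<nu> = \<rho>"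
proof -
  have "\<forall>x\<in>set \<rho>. x \<le> int (nat (\<mu> ! 0))"
  proof
    fix x assume "x \<in> set \<rho>"
    then obtain i where i: "i < n" "x = \<rho> ! i"
      using assms(2) by (auto simp: in_set_conv_nth is_partition_def)
    then show "x \<le> int (nat (\<mu> ! 0))"
      using assms(3)[of i] partition_mono[OF assms(1), of 0 i] by simp
  qed
  then have "conjugate n (conjugate (nat (\<mu> ! 0)) \<rho>) = \<rho>"
    using conjugate_conjugate assms(2) by blast
  then show ?thesis
    using assms sort_desc_eqI[OF assms(5) sorted_conjugate]
    by (simp add: backward_rule_def Let_def partition_length)
qed

lemma backward_rule_same:
  assumes "is_partition n \<mu>" "is_partition n \<kappa>" "n \<ge> 1"
    and "\<kappa> = \<mu> \<or> (\<exists>x<n. \<kappa> = remove_cell x \<mu>)"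
  shows "backward_rule \<kappa> \<mu> \<mu> = \<kappa>" "\<not> has_cross \<kappa> \<mu> \<mu>"
    and "backward_rule \<mu> \<mu> \<kappa> = \<kappa>" "\<not> has_cross \<mu> \<mu> \<kappa>"
proof -
  show 1: "\<not> has_cross \<kappa> \<mu> \<mu>"
    using assms by (auto simp: has_cross_def add_cell_eq_iff partition_length)
  show 2: "backward_rule \<kappa> \<mu> \<mu> = \<kappa>"
    using assms(1,2) _ 1
  proof (rule backward_rule_eqI)
    show "\<kappa> ! i \<le> \<mu> ! i" if "i < n" for i
      using assms that by (auto simp: nth_remove_cell partition_length)
    show "mset (vsub (vadd (conjugate (nat (\<mu> ! 0)) \<kappa>) (conjugate (nat (\<mu> ! 0)) \<mu>))
               (conjugate (nat (\<mu> ! 0)) \<mu>)) = mset (conjugate (nat (\<mu> ! 0)) \<kappa>)"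
      by (rule arg_cong[where f = mset], rule nth_equalityI) (simp_all add: nth_vsub nth_vadd)
  qed
  show "backward_rule \<mu> \<mu> \<kappa> = \<kappa>" "\<not> has_cross \<mu> \<mu> \<kappa>"
    using 1 2 backward_rule_commute has_cross_commute by metis+
qed

lemma backward_rule_distinct:
  assumes "is_partition n \<mu>" "is_partition n (remove_cell x \<mu>)" "is_partition n (remove_cell y \<mu>)"
    and "x < n" "y < n" "x \<noteq> y"
  shows "backward_rule (remove_cell x \<mu>) \<mu> (remove_cell y \<mu>) = remove_cell y (remove_cell x \<mu>)"
    and "\<not> has_cross (remove_cell x \<mu>) \<mu> (remove_cell y \<mu>)"
proof -
  note len [simp] = partition_length[OF assms(1)]
  show 1: "\<not> has_cross (remove_cell x \<mu>) \<mu> (remove_cell y \<mu>)"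
    using assms by (auto simp: has_cross_def)
  show "backward_rule (remove_cell x \<mu>) \<mu> (remove_cell y \<mu>) = remove_cell y (remove_cell x \<mu>)"
    using assms(1) _ _ 1
  proof (rule backward_rule_eqI)
    show "is_partition n (remove_cell y (remove_cell x \<mu>))"
      by (rule partition_remove_two) (use assms in auto)
    let ?m = "nat (\<mu> ! 0)"
    show "mset (vsub (vadd (conjugate ?m (remove_cell x \<mu>)) (conjugate ?m (remove_cell y \<mu>)))
            (conjugate ?m \<mu>)) = mset (conjugate ?m (remove_cell y (remove_cell x \<mu>)))"
      by (rule arg_cong[where f = mset], rule nth_equalityI)
        (use assms in \<open>simp_all add: nth_vsub nth_vadd nth_conjugate_remove_cell nth_remove_cell\<close>)
  qed (simp add: nth_remove_cell)
qed

text \<open>A cell that can be removed is at the bottom of its column, so its row determines the height of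
the column.\<close>

lemma conjugate_at_corner:
  assumes "is_partition n v" "is_partition n (remove_cell x v)" "x < n" "j < m" "v ! x = int j + 1"
  shows "conjugate m v ! j = int x + 1"
proof -
  have "{i. i < length v \<and> int j < v ! i} = {..x}"
  proof (intro set_eqI iffI)
    fix i assume i: "i \<in> {i. i < length v \<and> int j < v ! i}"
    show "i \<in> {..x}"
    proof (rule ccontr)
      assume "i \<notin> {..x}"
      then have "Suc x \<le> i" "i < n" using i partition_length[OF assms(1)] by auto
      then have "v ! i \<le> v ! Suc x" "v ! Suc x < v ! x"
        using partition_mono[OF assms(1), of "Suc x" i] assms(2)
          partition_remove_cell[OF assms(1,3)] by auto
      then show False using i assms by simp
    qed
  next
    fix i assume "i \<in> {..x}"
    then show "i \<in> {i. i < length v \<and> int j < v ! i}"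
      using partition_mono[OF assms(1), of i x] assms by (auto simp: partition_length)
  qed
  then show ?thesis using assms by (simp add: nth_conjugate)
qed

text \<open>This is row insertion run backwards: a cell that leaves row \<open>x + 1\<close> twice is
bumped out of row \<open>x\<close>, whatever the shape. In terms of columns, the sort in the
backward rule exchanges two entries that differ by one, unless the two columns concerned
coincide.\<close>

lemma backward_rule_bump:
  assumes "is_partition n \<mu>" "is_partition n (remove_cell (Suc x) \<mu>)" "Suc x < n"
  shows "backward_rule (remove_cell (Suc x) \<mu>) \<mu> (remove_cell (Suc x) \<mu>)
      = remove_cell x (remove_cell (Suc x) \<mu>)"
    and "\<not> has_cross (remove_cell (Suc x) \<mu>) \<mu> (remove_cell (Suc x) \<mu>)"
    and "is_partition n (remove_cell x (remove_cell (Suc x) \<mu>))"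
proof -
  note len [simp] = partition_length[OF assms(1)]
  let ?\<kappa> = "remove_cell (Suc x) \<mu>"
  let ?\<rho> = "remove_cell x ?\<kappa>"
  let ?m = "nat (\<mu> ! 0)"
  show 1: "\<not> has_cross ?\<kappa> \<mu> ?\<kappa>"
    using assms by (auto simp: has_cross_def add_cell_eq_iff)
  have pos: "0 < \<mu> ! Suc x" "\<mu> ! Suc x \<le> \<mu> ! x" "\<mu> ! x \<le> \<mu> ! 0"
    using assms partition_remove_cell[OF assms(1,3)] partition_mono[OF assms(1), of x "Suc x"]
      partition_mono[OF assms(1), of 0 x] by auto
  show 2: "is_partition n ?\<rho>"
    using assms pos by (subst partition_remove_cell) (auto simp: nth_remove_cell)
  \<comment> \<open>The columns, counted from 0, of the last cells of rows x and x + 1.\<close>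
  define p where "p = nat (\<mu> ! x - 1)"
  define q where "q = nat (\<mu> ! Suc x - 1)"
  have pq: "\<mu> ! x = int p + 1" "\<mu> ! Suc x = int q + 1" "p < ?m" "q < ?m"
    using pos by (auto simp: p_def q_def)
  have hq: "conjugate ?m \<mu> ! q = int x + 2"
    using conjugate_at_corner[OF assms(1,2,3), of q ?m] pq by simp
  have hp: "conjugate ?m ?\<kappa> ! p = int x + 1"
    using conjugate_at_corner[OF assms(2) 2, of p ?m] pq assms by (simp add: nth_remove_cell)
  show "backward_rule ?\<kappa> \<mu> ?\<kappa> = ?\<rho>"
    using assms(1) 2 _ 1
  proof (rule backward_rule_eqI)
    show "mset (vsub (vadd (conjugate ?m ?\<kappa>) (conjugate ?m ?\<kappa>)) (conjugate ?m \<mu>))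
        = mset (conjugate ?m ?\<rho>)"
    \<comment> \<open>If p and q differ, the left-hand vector has x + 1 at p and x at q, and the right-hand one
      vice versa; if they agree, the two vectors are equal.\<close>
    proof (rule mset_swap_values[where p = p and q = q])
    qed (use assms pq hp hq in \<open>auto simp: nth_vsub nth_vadd nth_conjugate_remove_cell
        nth_remove_cell split: if_splits\<close>)
  qed (simp add: nth_remove_cell)
qed

lemma backward_rule_cross:
  assumes "n \<ge> 1" "length \<mu> = n"
  shows "backward_rule (remove_cell 0 \<mu>) \<mu> (remove_cell 0 \<mu>) = remove_cell 0 \<mu>"
    and "has_cross (remove_cell 0 \<mu>) \<mu> (remove_cell 0 \<mu>)"
  using assms by (auto simp: backward_rule_def has_cross_def)

lemma backward_rule_partition:
  assumes n: "n \<ge> 1" and parts: "is_partition n \<kappa>" "is_partition n \<mu>" "is_partition n \<nu>"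
    and cov: "weakly_covered \<kappa> \<mu>" "weakly_covered \<nu> \<mu>"
  shows "is_partition n (backward_rule \<kappa> \<mu> \<nu>)"
    and "weakly_covered (backward_rule \<kappa> \<mu> \<nu>) \<kappa>" "weakly_covered (backward_rule \<kappa> \<mu> \<nu>) \<nu>"
proof -
  note len [simp] = partition_length[OF parts(2)]
  have k: "\<kappa> = \<mu> \<or> (\<exists>x<n. \<kappa> = remove_cell x \<mu>)" and v: "\<nu> = \<mu> \<or> (\<exists>x<n. \<nu> = remove_cell x \<mu>)"
    using cov by (auto simp: weakly_covered_def covered_def)
  have "is_partition n (backward_rule \<kappa> \<mu> \<nu>) \<and> weakly_covered (backward_rule \<kappa> \<mu> \<nu>) \<kappa>
    \<and> weakly_covered (backward_rule \<kappa> \<mu> \<nu>) \<nu>"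
  proof (cases "\<kappa> = \<mu> \<or> \<nu> = \<mu>")
    case True
    then show ?thesis
      using backward_rule_same(1)[OF parts(2,1) n k] backward_rule_same(3)[OF parts(2,3) n v]
        parts cov by (auto simp: weakly_covered_def)
  next
    case False
    then obtain x y where xy: "x < n" "\<kappa> = remove_cell x \<mu>" "y < n" "\<nu> = remove_cell y \<mu>"
      using k v by auto
    show ?thesis
    proof (cases "x = y")
      case neq: False
      have "remove_cell y (remove_cell x \<mu>) = remove_cell x \<nu>"
        using remove_cell_commute xy by simp
      then have "covered (remove_cell y (remove_cell x \<mu>)) \<nu>" using xy by (auto simp: covered_def)
      moreover have "covered (remove_cell y (remove_cell x \<mu>)) \<kappa>"
        using xy by (auto simp: covered_def)
      ultimately show ?thesis
        using backward_rule_distinct[of n \<mu> x y] partition_remove_two[of n \<mu> x y] parts neq xy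
        by (simp add: weakly_covered_def)
    next
      case True
      then show ?thesis
        using xy backward_rule_cross(1)[OF n len] parts backward_rule_bump[of n \<mu> "x - 1"]
        by (cases x) (auto simp: weakly_covered_def covered_def)
    qed
  qed
  then show "is_partition n (backward_rule \<kappa> \<mu> \<nu>)" "weakly_covered (backward_rule \<kappa> \<mu> \<nu>) \<kappa>"
    "weakly_covered (backward_rule \<kappa> \<mu> \<nu>) \<nu>" by auto
qed

section \<open>Growth faces and the cube lemma\<close>

text \<open>Here and below \<open>\<rho>\<close> is the smallest and \<open>\<mu>\<close> the largest of
four shapes, while \<open>\<alpha>\<close> and \<open>\<beta>\<close> lie between them.\<close>

definition commuting_square :: "int list \<Rightarrow> int list \<Rightarrow> int list \<Rightarrow> int list \<Rightarrow> bool" where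
  "commuting_square \<rho> \<alpha> \<beta> \<mu> \<longleftrightarrow>
     (\<exists>x<length \<mu>. \<exists>y<length \<mu>. x \<noteq> y \<and> \<alpha> = remove_cell x \<mu> \<and> \<beta> = remove_cell y \<mu>
        \<and> \<rho> = remove_cell y (remove_cell x \<mu>))"

text \<open>Jeu de taquin: \<open>\<alpha>\<close> and \<open>\<beta>\<close> agree only if there is just
one shape strictly between \<open>\<rho>\<close> and \<open>\<mu>\<close>, that is, if the two
removed cells are neighbours in a row or in a column.\<close>

definition jdt_square :: "int list \<Rightarrow> int list \<Rightarrow> int list \<Rightarrow> int list \<Rightarrow> bool" where
  "jdt_square \<rho> \<alpha> \<beta> \<mu> \<longleftrightarrow> commuting_square \<rho> \<alpha> \<beta> \<mu> \<or>
     \<alpha> = \<beta> \<and> (\<exists>x<length \<mu>. \<exists>t<length \<mu>. \<alpha> = remove_cell x \<mu> \<and> \<rho> = remove_cell t \<alpha> \<and>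
       (t = x \<or> Suc t = x \<and> \<mu> ! t = \<mu> ! x))"

text \<open>Column insertion, the conjugate of the backward rule: if \<open>\<alpha> = \<beta>\<close>, the
cell between \<open>\<rho>\<close> and \<open>\<alpha>\<close> lies in the column immediately
to the left of the cell between \<open>\<alpha>\<close> and \<open>\<mu>\<close>.\<close>

definition dual_square :: "int list \<Rightarrow> int list \<Rightarrow> int list \<Rightarrow> int list \<Rightarrow> bool" where
  "dual_square \<rho> \<alpha> \<beta> \<mu> \<longleftrightarrow> commuting_square \<rho> \<alpha> \<beta> \<mu> \<or>
     \<alpha> = \<beta> \<and> (\<exists>x<length \<mu>. \<exists>t<length \<mu>. \<alpha> = remove_cell x \<mu> \<and> \<rho> = remove_cell t \<alpha> \<and>
       \<alpha> ! x = \<alpha> ! t)"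

text \<open>The faces also allow for a degenerate case, where the steps from \<open>\<rho>\<close> to
\<open>\<beta>\<close> and from \<open>\<alpha>\<close> to \<open>\<mu>\<close> are trivial.\<close>

definition jdt_face :: "int list \<Rightarrow> int list \<Rightarrow> int list \<Rightarrow> int list \<Rightarrow> bool" where
  "jdt_face \<rho> \<alpha> \<beta> \<mu> \<longleftrightarrow> \<rho> = \<beta> \<and> \<alpha> = \<mu> \<and> covered \<rho> \<alpha> \<or> jdt_square \<rho> \<alpha> \<beta> \<mu>"

definition dual_face :: "int list \<Rightarrow> int list \<Rightarrow> int list \<Rightarrow> int list \<Rightarrow> bool" where
  "dual_face \<rho> \<alpha> \<beta> \<mu> \<longleftrightarrow> \<rho> = \<beta> \<and> \<alpha> = \<mu> \<and> covered \<rho> \<alpha> \<or> dual_square \<rho> \<alpha> \<beta> \<mu>"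

text \<open>The added cell lies in the first column, where column insertion finds no column further to the
left.\<close>

definition adds_row :: "int list \<Rightarrow> int list \<Rightarrow> bool" where
  "adds_row \<kappa> \<mu> \<longleftrightarrow> (\<exists>k<length \<mu>. \<kappa> = remove_cell k \<mu> \<and> \<mu> ! k = 1)"

lemma adds_row_covered: "adds_row \<kappa> \<mu> \<Longrightarrow> covered \<kappa> \<mu>"
  by (auto simp: adds_row_def covered_def)

lemma commuting_squareI:
  assumes "x < length \<mu>" "y < length \<mu>" "x \<noteq> y" "\<alpha> = remove_cell x \<mu>" "\<beta> = remove_cell y \<mu>"
    "\<rho> = remove_cell y \<alpha>"
  shows "commuting_square \<rho> \<alpha> \<beta> \<mu>"
  using assms unfolding commuting_square_def by blast

lemma jdt_face_commuting: "commuting_square \<rho> \<alpha> \<beta> \<mu> \<Longrightarrow> jdt_face \<rho> \<alpha> \<beta> \<mu>"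
  by (simp add: jdt_face_def jdt_square_def)

lemma dual_face_commuting: "commuting_square \<rho> \<alpha> \<beta> \<mu> \<Longrightarrow> dual_face \<rho> \<alpha> \<beta> \<mu>"
  by (simp add: dual_face_def dual_square_def)

lemma jdt_face_chain:
  assumes "x < length \<mu>" "t < length \<mu>" "\<alpha> = remove_cell x \<mu>" "\<beta> = \<alpha>" "\<rho> = remove_cell t \<alpha>"
    "t = x \<or> Suc t = x \<and> \<mu> ! t = \<mu> ! x"
  shows "jdt_face \<rho> \<alpha> \<beta> \<mu>"
  using assms unfolding jdt_face_def jdt_square_def by blast

lemma dual_face_chain:
  assumes "x < length \<mu>" "t < length \<mu>" "\<alpha> = remove_cell x \<mu>" "\<beta> = \<alpha>" "\<rho> = remove_cell t \<alpha>"
    "\<alpha> ! x = \<alpha> ! t"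
  shows "dual_face \<rho> \<alpha> \<beta> \<mu>"
  using assms unfolding dual_face_def dual_square_def by blast

lemma jdt_square_edges:
  assumes "jdt_square \<rho> \<alpha> \<beta> \<mu>"
  shows "covered \<rho> \<alpha>" "covered \<rho> \<beta>" "covered \<alpha> \<mu>" "covered \<beta> \<mu>"
  using assms remove_cell_commute length_remove_cell
  by (fastforce simp: jdt_square_def commuting_square_def covered_def)+

lemma dual_square_edges:
  assumes "dual_square \<rho> \<alpha> \<beta> \<mu>"
  shows "covered \<rho> \<alpha>" "covered \<rho> \<beta>" "covered \<alpha> \<mu>" "covered \<beta> \<mu>"
  using assms remove_cell_commute length_remove_cell
  by (fastforce simp: dual_square_def commuting_square_def covered_def)+

lemma jdt_face_covered: "jdt_face \<rho> \<alpha> \<beta> \<mu> \<Longrightarrow> covered \<rho> \<alpha> \<and> covered \<beta> \<mu>"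
  using jdt_square_edges by (auto simp: jdt_face_def)

lemma dual_face_covered: "dual_face \<rho> \<alpha> \<beta> \<mu> \<Longrightarrow> covered \<rho> \<alpha> \<and> covered \<beta> \<mu>"
  using dual_square_edges by (auto simp: dual_face_def)

text \<open>Let \<open>x\<close>, \<open>y\<close> and \<open>s\<close> be the rows of the cells that lead
from \<open>\<mu>\<close> down to \<open>\<kappa>\<close>, \<open>\<nu>\<close> and
\<open>\<mu>'\<close>. Each of the three rules for faces lets two different rows pass through
each other. If the two rows are equal, they change: row insertion moves up by one row, column
insertion moves down to the last row of the same length, and jeu de taquin stays in the row or
moves up by one row of the same length. The claim is that three edges pass through each other
consistently, and the cases are the coincidences among \<open>x\<close>, \<open>y\<close> and
\<open>s\<close>.\<close>

lemma backward_cube: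
  assumes n: "n \<ge> 1"
    and parts: "is_partition n \<kappa>" "is_partition n \<mu>" "is_partition n \<nu>"
      "is_partition n \<kappa>'" "is_partition n \<mu>'" "is_partition n \<nu>'"
    and jdt: "jdt_face \<kappa>' \<kappa> \<mu>' \<mu>" and dual: "dual_face \<nu>' \<nu> \<mu>' \<mu>"
  shows "jdt_face (backward_rule \<kappa>' \<mu>' \<nu>') (backward_rule \<kappa> \<mu> \<nu>) \<nu>' \<nu>
    \<and> dual_face (backward_rule \<kappa>' \<mu>' \<nu>') (backward_rule \<kappa> \<mu> \<nu>) \<kappa>' \<kappa>
    \<and> (has_cross \<kappa>' \<mu>' \<nu>' \<longleftrightarrow> has_cross \<kappa> \<mu> \<nu>)"
proof (cases "jdt_square \<kappa>' \<kappa> \<mu>' \<mu> \<and> dual_square \<nu>' \<nu> \<mu>' \<mu>")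
  case False
  note len = partition_length
  consider "\<kappa>' = \<mu>'" "\<kappa> = \<mu>" | "\<nu>' = \<mu>'" "\<nu> = \<mu>"
    using False jdt dual by (auto simp: jdt_face_def dual_face_def)
  then show ?thesis
  proof cases
    case 1
    have "\<nu> = \<mu> \<or> (\<exists>x<n. \<nu> = remove_cell x \<mu>)" "\<nu>' = \<mu>' \<or> (\<exists>x<n. \<nu>' = remove_cell x \<mu>')"
      using dual parts dual_square_edges[of \<nu>' \<nu> \<mu>' \<mu>]
      by (auto simp: dual_face_def covered_def len)
    then show ?thesis
      using 1 backward_rule_same(3,4)[OF parts(2,3) n] backward_rule_same(3,4)[OF parts(5,6) n]
        dual_face_covered[OF dual] dual by (auto simp: jdt_face_def)
  next
    case 2
    have "\<kappa> = \<mu> \<or> (\<exists>x<n. \<kappa> = remove_cell x \<mu>)" "\<kappa>' = \<mu>' \<or> (\<exists>x<n. \<kappa>' = remove_cell x \<mu>')"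
      using jdt parts jdt_square_edges[of \<kappa>' \<kappa> \<mu>' \<mu>]
      by (auto simp: jdt_face_def covered_def len)
    then show ?thesis
      using 2 backward_rule_same(1,2)[OF parts(2,1) n] backward_rule_same(1,2)[OF parts(5,4) n]
        jdt_face_covered[OF jdt] jdt by (auto simp: dual_face_def)
  qed
next
  case True
  note len [simp] = partition_length[OF parts(2)]
  from True obtain x s where xs: "x < n" "s < n" "\<kappa> = remove_cell x \<mu>" "\<mu>' = remove_cell s \<mu>"
    and J: "x \<noteq> s \<and> \<kappa>' = remove_cell s \<kappa> \<or>
      x = s \<and> (\<exists>t<n. \<kappa>' = remove_cell t \<kappa> \<and> (t = x \<or> Suc t = x \<and> \<mu> ! t = \<mu> ! x))"
    by (auto simp: jdt_square_def commuting_square_def)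
  from True xs obtain y where y: "y < n" "\<nu> = remove_cell y \<mu>"
    and D: "y \<noteq> s \<and> \<nu>' = remove_cell s \<nu> \<or>
      y = s \<and> (\<exists>u<n. \<nu>' = remove_cell u \<nu> \<and> \<nu> ! y = \<nu> ! u)"
    by (auto simp: dual_square_def commuting_square_def)
  note com = remove_cell_commute
  consider "x \<noteq> y" "x \<noteq> s" "y \<noteq> s" | "x = y" "x \<noteq> s" | "x = s" "x \<noteq> y" | "y = s" "x \<noteq> y"
    | "x = y" "x = s" by blast
  then show ?thesis
  proof cases
    case 1
    have "\<kappa>' = remove_cell x \<mu>'" "\<nu>' = remove_cell y \<mu>'"
      using 1 J D xs y com by auto
    then have rules: "backward_rule \<kappa>' \<mu>' \<nu>' = remove_cell y \<kappa>'" "\<not> has_cross \<kappa>' \<mu>' \<nu>'"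
      "backward_rule \<kappa> \<mu> \<nu> = remove_cell y \<kappa>" "\<not> has_cross \<kappa> \<mu> \<nu>"
      using backward_rule_distinct[of n \<mu>' x y] backward_rule_distinct[of n \<mu> x y] 1 parts xs y
      by auto
    have "commuting_square (remove_cell y \<kappa>') (remove_cell y \<kappa>) \<nu>' \<nu>"
      by (rule commuting_squareI[of x _ s]) (use 1 J D xs y com in auto)
    moreover have "commuting_square (remove_cell y \<kappa>') (remove_cell y \<kappa>) \<kappa>' \<kappa>"
      by (rule commuting_squareI[of y _ s]) (use 1 J D xs y com in auto)
    ultimately show ?thesis
      using rules jdt_face_commuting dual_face_commuting by simp
  next
    case 2
    have k': "\<kappa>' = remove_cell x \<mu>'" "\<nu>' = remove_cell x \<mu>'" "\<nu> = \<kappa>" "\<nu>' = \<kappa>'"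
      "\<kappa>' = remove_cell s \<kappa>"
      using 2 J D xs y com by auto
    show ?thesis
    proof (cases x)
      case 0
      have "backward_rule \<kappa>' \<mu>' \<nu>' = \<kappa>'" "has_cross \<kappa>' \<mu>' \<nu>'"
        "backward_rule \<kappa> \<mu> \<nu> = \<kappa>" "has_cross \<kappa> \<mu> \<nu>"
        using backward_rule_cross[OF n, of \<mu>] backward_rule_cross[OF n, of \<mu>'] 0 k' xs by auto
      moreover have "covered \<kappa>' \<kappa>" using k' xs by (auto simp: covered_def)
      ultimately show ?thesis using k' by (simp add: jdt_face_def dual_face_def)
    next
      case (Suc p)
      have rules: "backward_rule \<kappa>' \<mu>' \<nu>' = remove_cell p \<kappa>'" "\<not> has_cross \<kappa>' \<mu>' \<nu>'"
        "backward_rule \<kappa> \<mu> \<nu> = remove_cell p \<kappa>" "\<not> has_cross \<kappa> \<mu> \<nu>"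
        using backward_rule_bump[of n \<mu> p] backward_rule_bump[of n \<mu>' p] Suc k' xs parts by auto
      show ?thesis
      proof (cases "s = p")
        case False
        then have "commuting_square (remove_cell p \<kappa>') (remove_cell p \<kappa>) \<kappa>' \<kappa>"
          by (intro commuting_squareI[of p _ s]) (use k' com xs Suc in auto)
        then show ?thesis using rules jdt_face_commuting dual_face_commuting k' by simp
      next
        case True
        have "jdt_face (remove_cell p \<kappa>') (remove_cell p \<kappa>) \<kappa>' \<kappa>"
          by (rule jdt_face_chain[of p _ p]) (use True k' xs in auto)
        moreover have "dual_face (remove_cell p \<kappa>') (remove_cell p \<kappa>) \<kappa>' \<kappa>"
          by (rule dual_face_chain[of p _ p]) (use True k' xs in auto)
        ultimately show ?thesis using rules k' by simp
      qed
    qed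
  next
    case 3
    obtain t where t: "t < n" "\<kappa>' = remove_cell t \<kappa>" "t = x \<or> Suc t = x \<and> \<mu> ! t = \<mu> ! x"
      using J 3 by auto
    have k': "\<kappa> = \<mu>'" "\<nu>' = remove_cell x \<nu>" "\<nu>' = remove_cell y \<mu>'"
      using 3 J D xs y com by auto
    \<comment> \<open>Otherwise the row y of \<mu> has the same length as the next row x, so it has no removable cell.\<close>
    have "t \<noteq> y"
    proof
      assume "t = y"
      then have "Suc y = x" "\<mu> ! y = \<mu> ! x" using t 3 by auto
      then show False
        using partition_remove_cell[of n \<mu> y] parts xs y by simp
    qed
    have rules: "backward_rule \<kappa>' \<mu>' \<nu>' = remove_cell y \<kappa>'" "\<not> has_cross \<kappa>' \<mu>' \<nu>'"
      "backward_rule \<kappa> \<mu> \<nu> = remove_cell y \<kappa>" "\<not> has_cross \<kappa> \<mu> \<nu>"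
      using backward_rule_distinct[of n \<mu>' t y] backward_rule_distinct[of n \<mu> x y]
        3 parts xs y k' t \<open>t \<noteq> y\<close> by auto
    have "jdt_face (remove_cell y \<kappa>') (remove_cell y \<kappa>) \<nu>' \<nu>"
      by (rule jdt_face_chain[of x _ t])
        (use 3 k' t xs y com \<open>t \<noteq> y\<close> in \<open>auto simp: nth_remove_cell\<close>)
    moreover have "commuting_square (remove_cell y \<kappa>') (remove_cell y \<kappa>) \<kappa>' \<kappa>"
      by (rule commuting_squareI[of y _ t]) (use k' t xs y com \<open>t \<noteq> y\<close> in auto)
    ultimately show ?thesis using rules dual_face_commuting by simp
  next
    case 4
    obtain u where u: "u < n" "\<nu>' = remove_cell u \<nu>" "\<nu> ! y = \<nu> ! u"
      using D 4 by auto
    have k': "\<nu> = \<mu>'" "\<kappa>' = remove_cell y \<kappa>" "\<kappa>' = remove_cell x \<mu>'"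
      using 4 J D xs y com by auto
    have "backward_rule \<kappa> \<mu> \<nu> = remove_cell y \<kappa>" "\<not> has_cross \<kappa> \<mu> \<nu>"
      using backward_rule_distinct[of n \<mu> x y] 4 parts xs y by auto
    then have rules: "backward_rule \<kappa> \<mu> \<nu> = \<kappa>'" "\<not> has_cross \<kappa> \<mu> \<nu>"
      using k' by auto
    show ?thesis
    proof (cases "x = u")
      case False
      have rules': "backward_rule \<kappa>' \<mu>' \<nu>' = remove_cell u \<kappa>'" "\<not> has_cross \<kappa>' \<mu>' \<nu>'"
        using backward_rule_distinct[of n \<mu>' x u] parts xs y k' u False by auto
      have "commuting_square (remove_cell u \<kappa>') \<kappa>' \<nu>' \<nu>"
        by (rule commuting_squareI[of x _ u]) (use k' u xs y com False in auto)
      moreover have "dual_face (remove_cell u \<kappa>') \<kappa>' \<kappa>' \<kappa>"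
        by (rule dual_face_chain[of y _ u])
          (use 4 k' u xs y com False in \<open>auto simp: nth_remove_cell\<close>)
      ultimately show ?thesis using rules rules' jdt_face_commuting by simp
    next
      case True
      \<comment> \<open>In \<nu>, row y has the same length as row u = x, which is the last row of its length.\<close>
      have less: "y < x"
      proof (rule ccontr)
        assume "\<not> y < x"
        then have "Suc u \<le> y" using True 4 by simp
        then have "\<nu> ! y \<le> \<nu> ! Suc u" "\<nu> ! Suc u < \<nu> ! u"
          using partition_mono[OF parts(3), of "Suc u" y] partition_remove_cell[OF parts(3) u(1)]
            parts u y by auto
        then show False using u by simp
      qed
      then obtain p where p: "x = Suc p" "y \<le> p" by (cases x) auto
      have eq: "\<nu> ! p = \<nu> ! x" "\<nu> ! p = \<nu> ! y"
        using partition_mono[OF parts(3), of y p] partition_mono[OF parts(3), of p x] p True u xs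
        by auto
      have rules': "backward_rule \<kappa>' \<mu>' \<nu>' = remove_cell p \<kappa>'" "\<not> has_cross \<kappa>' \<mu>' \<nu>'"
        using backward_rule_bump[of n \<mu>' p] parts xs k' u True p by auto
      have "jdt_face (remove_cell p \<kappa>') \<kappa>' \<nu>' \<nu>"
        by (rule jdt_face_chain[of x _ p]) (use k' u xs True p eq in auto)
      moreover have "dual_face (remove_cell p \<kappa>') \<kappa>' \<kappa>' \<kappa>"
        by (rule dual_face_chain[of y _ p])
          (use 4 k' xs y p eq in \<open>auto simp: nth_remove_cell\<close>)
      ultimately show ?thesis using rules rules' by simp
    qed
  next
    case 5
    obtain t where t: "t < n" "\<kappa>' = remove_cell t \<kappa>" "t = x \<or> Suc t = x \<and> \<mu> ! t = \<mu> ! x"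
      using J 5 by auto
    obtain u where u: "u < n" "\<nu>' = remove_cell u \<nu>" "\<nu> ! x = \<nu> ! u"
      using D 5 by auto
    have k': "\<nu> = \<kappa>" "\<mu>' = \<kappa>"
      using 5 xs y by auto
    \<comment> \<open>Row u is the last one of its length.\<close>
    have "x \<le> u"
    proof (rule ccontr)
      assume "\<not> x \<le> u"
      then have "\<nu> ! x \<le> \<nu> ! Suc u" "\<nu> ! Suc u < \<nu> ! u"
        using partition_mono[OF parts(3), of "Suc u" x] partition_remove_cell[OF parts(3) u(1)]
          parts u xs by auto
      then show False using u by simp
    qed
    show ?thesis
    proof (cases "t = x")
      case True
      have "u = x"
      proof (rule ccontr)
        assume "u \<noteq> x"
        then have "Suc x \<le> u" using \<open>x \<le> u\<close> by simp
        then have "\<nu> ! u \<le> \<nu> ! Suc x" "\<nu> ! Suc x < \<nu> ! x"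
          using partition_mono[OF parts(3), of "Suc x" u]
            partition_remove_cell[OF parts(1) xs(1)] parts(4) t True u k' by auto
        then show False using u by simp
      qed
      then have \<nu>': "\<nu>' = \<kappa>'" using u t True k' by simp
      show ?thesis
      proof (cases x)
        case 0
        have "backward_rule \<kappa>' \<mu>' \<nu>' = \<kappa>'" "has_cross \<kappa>' \<mu>' \<nu>'"
          "backward_rule \<kappa> \<mu> \<nu> = \<kappa>" "has_cross \<kappa> \<mu> \<nu>"
          using backward_rule_cross[OF n, of \<mu>] backward_rule_cross[OF n, of \<mu>'] 0 k' \<nu>' xs t True
          by auto
        moreover have "covered \<kappa>' \<kappa>" using t xs by (auto simp: covered_def)
        ultimately show ?thesis using k' \<nu>' by (simp add: jdt_face_def dual_face_def)
      next
        case (Suc p)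
        have rules: "backward_rule \<kappa>' \<mu>' \<nu>' = remove_cell p \<kappa>'" "\<not> has_cross \<kappa>' \<mu>' \<nu>'"
          "backward_rule \<kappa> \<mu> \<nu> = remove_cell p \<kappa>" "\<not> has_cross \<kappa> \<mu> \<nu>"
          using backward_rule_bump[of n \<mu> p] backward_rule_bump[of n \<mu>' p] Suc k' \<nu>' xs t True parts
          by auto
        have "commuting_square (remove_cell p \<kappa>') (remove_cell p \<kappa>) \<kappa>' \<kappa>"
          by (intro commuting_squareI[of p _ x]) (use k' com xs Suc t True in auto)
        then show ?thesis using rules jdt_face_commuting dual_face_commuting k' \<nu>' by simp
      qed
    next
      case False
      then have t': "Suc t = x" "\<mu> ! t = \<mu> ! x" using t by auto
      have rules: "backward_rule \<kappa> \<mu> \<nu> = \<kappa>'" "\<not> has_cross \<kappa> \<mu> \<nu>"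
        using backward_rule_bump[of n \<mu> t] t' k' xs t parts by auto
      have "t \<noteq> u" using t' \<open>x \<le> u\<close> by auto
      then have rules': "backward_rule \<kappa>' \<mu>' \<nu>' = remove_cell u \<kappa>'" "\<not> has_cross \<kappa>' \<mu>' \<nu>'"
        using backward_rule_distinct[of n \<mu>' t u] parts k' u t by auto
      have "commuting_square (remove_cell u \<kappa>') \<kappa>' \<nu>' \<nu>"
        by (rule commuting_squareI[of t _ u]) (use k' u t com \<open>t \<noteq> u\<close> xs in auto)
      moreover have "dual_face (remove_cell u \<kappa>') \<kappa>' \<kappa>' \<kappa>"
        by (rule dual_face_chain[of t _ u])
          (use k' u t t' xs \<open>t \<noteq> u\<close> in \<open>auto simp: nth_remove_cell split: if_splits\<close>)
      ultimately show ?thesis using rules rules' jdt_face_commuting by simp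
    qed
  qed
qed

text \<open>The cube on the line where the diagrams begin to differ: three corners of its right face are
\<open>\<mu>'\<close>, and the fourth one has an additional row. The conclusion says that its
left face is of the same kind, so that this situation is passed on along the whole line.\<close>

lemma backward_fold:
  assumes n: "n \<ge> 1"
    and parts: "is_partition n \<kappa>" "is_partition n \<mu>" "is_partition n \<kappa>'" "is_partition n \<mu>'"
    and jdt: "jdt_face \<kappa>' \<kappa> \<mu>' \<mu>" and row: "adds_row \<mu>' \<mu>"
  shows "backward_rule \<kappa> \<mu> \<mu>' = \<kappa>'" "\<not> has_cross \<kappa> \<mu> \<mu>'" "adds_row \<kappa>' \<kappa>"
    and "backward_rule \<kappa>' \<mu>' \<mu>' = \<kappa>'" "\<not> has_cross \<kappa>' \<mu>' \<mu>'"
proof -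
  note len [simp] = partition_length[OF parts(2)] partition_length[OF parts(4)]
  obtain s where s: "s < n" "\<mu>' = remove_cell s \<mu>" "\<mu> ! s = 1"
    using row by (auto simp: adds_row_def)
  have "\<kappa>' = \<mu>' \<or> (\<exists>x<n. \<kappa>' = remove_cell x \<mu>')"
    using jdt jdt_square_edges[of \<kappa>' \<kappa> \<mu>' \<mu>] by (auto simp: jdt_face_def covered_def)
  then show "backward_rule \<kappa>' \<mu>' \<mu>' = \<kappa>'" "\<not> has_cross \<kappa>' \<mu>' \<mu>'"
    using backward_rule_same[OF parts(4,3) n] by auto
  have "backward_rule \<kappa> \<mu> \<mu>' = \<kappa>' \<and> \<not> has_cross \<kappa> \<mu> \<mu>' \<and> adds_row \<kappa>' \<kappa>"
  proof (cases "jdt_square \<kappa>' \<kappa> \<mu>' \<mu>")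
    case False
    then show ?thesis
      using jdt row backward_rule_same(3,4)[OF parts(2,4) n] s by (auto simp: jdt_face_def)
  next
    case True
    then obtain x where x: "x < n" "\<kappa> = remove_cell x \<mu>"
      and J: "x \<noteq> s \<and> \<kappa>' = remove_cell s \<kappa> \<or>
        x = s \<and> (\<exists>t<n. \<kappa>' = remove_cell t \<kappa> \<and> (t = x \<or> Suc t = x \<and> \<mu> ! t = \<mu> ! x))"
      using s by (auto simp: jdt_square_def commuting_square_def)
    show ?thesis
    proof (cases "x = s")
      case False
      then show ?thesis
        using backward_rule_distinct[of n \<mu> x s] J x s parts
        by (auto simp: adds_row_def nth_remove_cell)
    next
      case True
      then obtain t where t: "t < n" "\<kappa>' = remove_cell t \<kappa>" "t = x \<or> Suc t = x \<and> \<mu> ! t = \<mu> ! x"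
        using J by auto
      have "t \<noteq> x"
        using partition_nonneg[OF parts(3), of x] t True x s by (auto simp: nth_remove_cell)
      then have t': "x = Suc t" "\<mu> ! t = 1" using t s True by auto
      then show ?thesis
        using backward_rule_bump[of n \<mu> t] x s t True parts
        by (auto simp: adds_row_def nth_remove_cell)
    qed
  qed
  then show "backward_rule \<kappa> \<mu> \<mu>' = \<kappa>'" "\<not> has_cross \<kappa> \<mu> \<mu>'" "adds_row \<kappa>' \<kappa>"
    by auto
qed

section \<open>The local rule of promotion and evacuation\<close>

text \<open>The squares in which an absolute value is taken: \<open>B + C - A\<close> has an entry
\<open>-1\<close>.\<close>

definition fold_square :: "int list \<Rightarrow> int list \<Rightarrow> int list \<Rightarrow> int list \<Rightarrow> bool" where
  "fold_square A B C D \<longleftrightarrow> B = C \<and> A = D \<and> adds_row B A"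

text \<open>The four unfolded forms correspond to the possible directions of \<open>A B\<close> and
\<open>A C\<close>: if one step adds and the other one removes a cell, the square is a jeu de
taquin square, and otherwise it is a column insertion square. This form of the rule makes its
symmetry manifest.\<close>

definition local_rule :: "int list \<Rightarrow> int list \<Rightarrow> int list \<Rightarrow> int list \<Rightarrow> bool" where
  "local_rule A B C D \<longleftrightarrow> jdt_square C A D B \<or> jdt_square B A D C \<or>
     dual_square D B C A \<or> dual_square A B C D \<or> fold_square A B C D"

lemma commuting_square_commute: "commuting_square \<rho> \<alpha> \<beta> \<mu> \<Longrightarrow> commuting_square \<rho> \<beta> \<alpha> \<mu>"
  using remove_cell_commute by (fastforce simp: commuting_square_def)

lemma jdt_square_commute: "jdt_square \<rho> \<alpha> \<beta> \<mu> \<Longrightarrow> jdt_square \<rho> \<beta> \<alpha> \<mu>"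
  using commuting_square_commute by (auto simp: jdt_square_def)

lemma dual_square_commute: "dual_square \<rho> \<alpha> \<beta> \<mu> \<Longrightarrow> dual_square \<rho> \<beta> \<alpha> \<mu>"
  using commuting_square_commute by (auto simp: dual_square_def)

lemma fold_square_reverse: "fold_square A B C D \<longleftrightarrow> fold_square D B C A"
  by (auto simp: fold_square_def)

text \<open>This symmetry is what makes the array of the evacuation a reflection of the original array.\<close>

lemma local_rule_reverse: "local_rule A B C D \<Longrightarrow> local_rule D B C A"
  using jdt_square_commute fold_square_reverse unfolding local_rule_def by blast

lemma local_rule_adjacent:
  assumes "local_rule A B C D"
  shows "differ_by_cell B D" "differ_by_cell C D"
  using assms adds_row_covered
  by (auto simp: differ_by_cell_iff local_rule_def fold_square_def
      dest: jdt_square_edges dual_square_edges)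

lemma dominant_eqI:
  assumes "is_partition n w" "length v = n" "p < n" "q < n"
    and "\<bar>v ! p\<bar> = w ! q" "\<bar>v ! q\<bar> = w ! p"
    and "\<And>i. i < n \<Longrightarrow> i \<noteq> p \<Longrightarrow> i \<noteq> q \<Longrightarrow> \<bar>v ! i\<bar> = w ! i"
  shows "dominant v = w"
proof -
  have "mset (map abs v) = mset w"
    using assms by (intro mset_swap_values[of _ _ p q]) (auto simp: is_partition_def)
  then show ?thesis
    using assms sort_desc_eqI by (auto simp: dominant_def is_partition_def)
qed

lemma local_rule_dominant:
  assumes "is_partition n A" "is_partition n B" "is_partition n C" "is_partition n D"
    and "local_rule A B C D"
  shows "dominant (vsub (vadd C B) A) = D"
proof -
  have len: "length A = n" "length B = n" "length C = n" "length D = n"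
    using assms partition_length by auto
  have comm: "dominant (vsub (vadd C B) A) = D" if sq: "commuting_square \<rho> \<alpha> \<beta> \<mu>" and eqs:
    "\<rho> = A \<and> \<mu> = D \<and> {\<alpha>, \<beta>} = {B, C} \<or> \<rho> = D \<and> \<mu> = A \<and> {\<alpha>, \<beta>} = {B, C} \<or>
     {\<rho>, \<mu>} = {B, C} \<and> \<alpha> = A \<and> \<beta> = D" for \<rho> \<alpha> \<beta> \<mu>
  proof -
    obtain x y where xy: "x < length \<mu>" "y < length \<mu>" "x \<noteq> y" "\<alpha> = remove_cell x \<mu>"
      "\<beta> = remove_cell y \<mu>" "\<rho> = remove_cell y (remove_cell x \<mu>)"
      using sq by (auto simp: commuting_square_def)
    have "length \<mu> = n" using eqs len by (auto simp: doubleton_eq_iff)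
    then have "n > 0" using xy by auto
    have sum: "\<alpha> ! i + \<beta> ! i = \<rho> ! i + \<mu> ! i" if "i < n" for i
      using xy(3-) that \<open>length \<mu> = n\<close> by (simp add: nth_remove_cell)
    have *: "vsub (vadd C B) A ! i = D ! i" if "i < n" for i
      using eqs sum[OF that] that len by (auto simp: doubleton_eq_iff nth_vsub nth_vadd)
    show ?thesis
      by (rule dominant_eqI[OF assms(4), of _ 0 0])
        (use * partition_nonneg[OF assms(4)] len \<open>n > 0\<close> in auto)
  qed
  have jdt: "dominant (vsub (vadd C B) A) = D"
    if eqs: "\<alpha> = A" "\<beta> = D" "\<rho> = B \<and> \<mu> = C \<or> \<rho> = C \<and> \<mu> = B" and sq: "jdt_square \<rho> \<alpha> \<beta> \<mu>" for \<rho> \<alpha> \<beta> \<mu>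
  proof (cases "commuting_square \<rho> \<alpha> \<beta> \<mu>")
    case True
    then show ?thesis using comm eqs by auto
  next
    case False
    have l: "length \<mu> = n" using eqs(3) len by auto
    obtain x t where xt: "x < n" "t < n" "A = D" "A = remove_cell x \<mu>" "\<rho> = remove_cell t A"
      "t = x \<or> Suc t = x \<and> \<mu> ! t = \<mu> ! x"
      using sq False unfolding jdt_square_def l eqs(1,2) by blast
    have \<mu>: "\<mu> ! i = D ! i + (if i = x then 1 else 0)" "\<rho> ! i = D ! i - (if i = t then 1 else 0)"
      if "i < n" for i
      using nth_remove_cell[of i \<mu> x] nth_remove_cell[of i A t] l len that
      unfolding xt(4)[symmetric] xt(5)[symmetric] unfolding xt(3) by simp_all
    have v: "vsub (vadd C B) A ! i = D ! i + (if i = x then 1 else 0) - (if i = t then 1 else 0)"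
      if "i < n" for i
      using eqs(3) xt(3) \<mu>[OF that] that len by (auto simp: nth_vsub nth_vadd)
    have nn: "0 \<le> D ! i" if "i < n" for i using partition_nonneg[OF assms(4) that] .
    have "t = x \<or> D ! t = D ! x + 1"
      using xt(6) \<mu>(1)[OF xt(1)] \<mu>(1)[OF xt(2)] by auto
    then show ?thesis
      by (intro dominant_eqI[OF assms(4), of _ x t]) (use xt(1,2) v nn len in auto)
  qed
  have dual1: "dominant (vsub (vadd C B) A) = D" if d: "dual_square D B C A"
  proof (cases "commuting_square D B C A")
    case True
    then show ?thesis using comm by auto
  next
    case False
    then obtain x t where xt: "x < n" "t < n" "B = C" "B = remove_cell x A" "D = remove_cell t B"
      "B ! x = B ! t"
      using d len by (auto simp: dual_square_def)
    have D: "D ! i = B ! i - (if i = t then 1 else 0)" if "i < n" for i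
      using xt(5) len that by (simp add: nth_remove_cell)
    have v: "vsub (vadd C B) A ! i = B ! i - (if i = x then 1 else 0)" if "i < n" for i
      using nth_remove_cell[of i A x] len that
      unfolding xt(4)[symmetric] unfolding xt(3)[symmetric] by (simp add: nth_vsub nth_vadd)
    have nn: "0 \<le> B ! i" if "i < n" for i using partition_nonneg[OF assms(2) that] .
    have pos: "0 < B ! t" using partition_nonneg[OF assms(4) xt(2)] D[OF xt(2)] by simp
    show ?thesis
    proof (rule dominant_eqI[OF assms(4) _ xt(1,2)])
      have eq: "\<bar>vsub (vadd C B) A ! x\<bar> = D ! t \<and> \<bar>vsub (vadd C B) A ! t\<bar> = D ! x"
        using v[OF xt(1)] v[OF xt(2)] D[OF xt(1)] D[OF xt(2)] pos xt(6)
        by (cases "x = t") simp_all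
      show "\<bar>vsub (vadd C B) A ! x\<bar> = D ! t" using eq ..
      show "\<bar>vsub (vadd C B) A ! t\<bar> = D ! x" using eq ..
      show "\<bar>vsub (vadd C B) A ! i\<bar> = D ! i" if "i < n" "i \<noteq> x" "i \<noteq> t" for i
        using v[of i] D[of i] nn[of i] that by simp
    qed (use len in simp)
  qed
  have dual2: "dominant (vsub (vadd C B) A) = D" if d: "dual_square A B C D"
  proof (cases "commuting_square A B C D")
    case True
    then show ?thesis using comm by auto
  next
    case False
    then obtain x t where xt: "x < n" "t < n" "B = C" "B = remove_cell x D" "A = remove_cell t B"
      "B ! x = B ! t"
      using d len by (auto simp: dual_square_def)
    have D: "D ! i = B ! i + (if i = x then 1 else 0)" if "i < n" for i
      using nth_remove_cell[of i D x] len that unfolding xt(4)[symmetric] by simp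
    have v: "vsub (vadd C B) A ! i = B ! i + (if i = t then 1 else 0)" if "i < n" for i
      using nth_remove_cell[of i B t] len that
      unfolding xt(5)[symmetric] unfolding xt(3)[symmetric] by (simp add: nth_vsub nth_vadd)
    have nn: "0 \<le> B ! i" if "i < n" for i using partition_nonneg[OF assms(2) that] .
    show ?thesis
    proof (rule dominant_eqI[OF assms(4) _ xt(1,2)])
      have eq: "\<bar>vsub (vadd C B) A ! x\<bar> = D ! t \<and> \<bar>vsub (vadd C B) A ! t\<bar> = D ! x"
        using v[OF xt(1)] v[OF xt(2)] D[OF xt(1)] D[OF xt(2)] nn[OF xt(1)] nn[OF xt(2)] xt(6)
        by (cases "x = t") simp_all
      show "\<bar>vsub (vadd C B) A ! x\<bar> = D ! t" using eq ..
      show "\<bar>vsub (vadd C B) A ! t\<bar> = D ! x" using eq ..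
      show "\<bar>vsub (vadd C B) A ! i\<bar> = D ! i" if "i < n" "i \<noteq> x" "i \<noteq> t" for i
        using v[of i] D[of i] nn[of i] that by simp
    qed (use len in simp)
  qed
  have fold: "dominant (vsub (vadd C B) A) = D" if f: "fold_square A B C D"
  proof -
    obtain k where k: "k < n" "B = remove_cell k A" "A ! k = 1" "B = C" "A = D"
      using f len by (auto simp: fold_square_def adds_row_def)
    show ?thesis
      by (rule dominant_eqI[OF assms(4), of _ k k])
        (use k partition_nonneg[OF assms(4)] len
         in \<open>auto simp: nth_vsub nth_vadd nth_remove_cell\<close>)
  qed
  show ?thesis
    using assms(5) jdt dual1 dual2 fold unfolding local_rule_def by blast
qed

text \<open>If \<open>B = C\<close>, there are several rows in which \<open>B + C - A\<close> may differ
from \<open>B\<close>; among the rows of equal length, sorting moves an added cell to the first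
one and a removed cell to the last one.\<close>

lemma local_rule_exists:
  assumes parts: "is_partition n A" "is_partition n B" "is_partition n C"
    and "differ_by_cell A B" "differ_by_cell A C"
  shows "\<exists>D. is_partition n D \<and> local_rule A B C D"
proof -
  have chain: "\<exists>D. is_partition n D \<and> jdt_square \<rho> A D \<mu>"
    if c: "covered \<rho> A" "covered A \<mu>" and p: "is_partition n \<rho>" "is_partition n \<mu>" for \<rho> \<mu>
  proof -
    note len [simp] = partition_length[OF parts(1)] partition_length[OF p(2)]
    obtain x y where xy: "x < n" "\<rho> = remove_cell x A" "y < n" "A = remove_cell y \<mu>"
      using c by (auto simp: covered_def)
    show ?thesis
    proof (cases "x \<noteq> y \<and> is_partition n (remove_cell x \<mu>)")
      case True
      then have "commuting_square \<rho> A (remove_cell x \<mu>) \<mu>"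
        by (intro commuting_squareI[of y _ x]) (use xy in auto)
      then show ?thesis using True by (auto simp: jdt_square_def)
    next
      case False
      have "x = y \<or> Suc x = y \<and> \<mu> ! x = \<mu> ! y"
      proof (cases "x = y")
        case neq: False
        have "0 < A ! x" "Suc x < n \<Longrightarrow> A ! Suc x < A ! x"
          using partition_remove_cell[OF parts(1) xy(1)] p xy by auto
        moreover have "\<not> (0 < \<mu> ! x \<and> (Suc x < n \<longrightarrow> \<mu> ! Suc x < \<mu> ! x))"
          using False neq partition_remove_cell[OF p(2) xy(1)] by auto
        ultimately show ?thesis
          using xy neq partition_mono[OF p(2), of x "Suc x"]
          by (auto simp: nth_remove_cell split: if_splits)
      qed auto
      then have "jdt_square \<rho> A A \<mu>" using xy by (auto simp: jdt_square_def)
      then show ?thesis using parts by blast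
    qed
  qed
  consider "covered C A" "covered A B" | "covered B A" "covered A C"
    | "covered B A" "covered C A" | "covered A B" "covered A C"
    using assms by (auto simp: differ_by_cell_iff)
  then show ?thesis
  proof cases
    case 1
    then show ?thesis using chain[of C B] parts by (auto simp: local_rule_def)
  next
    case 2
    then show ?thesis using chain[of B C] parts by (auto simp: local_rule_def)
  next
    case 3
    note len [simp] = partition_length[OF parts(1)]
    obtain x y where xy: "x < n" "y < n" "B = remove_cell x A" "C = remove_cell y A"
      using 3 by (auto simp: covered_def)
    show ?thesis
    proof (cases "x = y")
      case False
      then have "is_partition n (remove_cell y B)"
        using partition_remove_two parts xy by auto
      moreover have "commuting_square (remove_cell y B) B C A"
        by (rule commuting_squareI[of x _ y]) (use xy False in auto)
      ultimately show ?thesis by (auto simp: local_rule_def dual_square_def)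
    next
      case True
      have "0 < A ! x" using partition_remove_cell[OF parts(1) xy(1)] parts xy by auto
      show ?thesis
      proof (cases "A ! x = 1")
        case True
        then have "fold_square A B C A"
          using xy \<open>x = y\<close> by (auto simp: fold_square_def adds_row_def)
        then show ?thesis using parts by (auto simp: local_rule_def)
      next
        case False
        then have pos: "0 < B ! x" using \<open>0 < A ! x\<close> xy by (simp add: nth_remove_cell)
        \<comment> \<open>The removed cell has to come from the last row of this length.\<close>
        define t where "t = Max {i. i < n \<and> B ! i = B ! x}"
        have "t \<in> {i. i < n \<and> B ! i = B ! x}"
          unfolding t_def by (rule Max_in) (use xy(1) in auto)
        then have t: "t < n" "B ! t = B ! x" by auto
        have tmax: "i \<le> t" if "i < n" "B ! i = B ! x" for i
          using Max_ge[of "{i. i < n \<and> B ! i = B ! x}" i] that by (auto simp: t_def)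
        have "B ! Suc t < B ! t" if "Suc t < n"
        proof -
          have "B ! Suc t \<noteq> B ! x" using tmax[of "Suc t"] that by linarith
          moreover have "B ! Suc t \<le> B ! t"
            using partition_mono[OF parts(2), of t "Suc t"] that by simp
          ultimately show ?thesis using t(2) by linarith
        qed
        then have "is_partition n (remove_cell t B)"
          using partition_remove_cell[OF parts(2) t(1)] pos t(2) by simp
        moreover have "dual_square (remove_cell t B) B C A"
          using xy True t by (auto simp: dual_square_def)
        ultimately show ?thesis by (auto simp: local_rule_def)
      qed
    qed
  next
    case 4
    note len [simp] = partition_length[OF parts(1)] partition_length[OF parts(2)]
      partition_length[OF parts(3)]
    obtain x y where xy: "x < n" "y < n" "B = add_cell x A" "C = add_cell y A"
      using 4 add_cell_eq_iff by (auto simp: covered_def)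
    show ?thesis
    proof (cases "x = y")
      case False
      have "is_partition n (add_cell y B)"
        using partition_add_cell[OF parts(2) xy(2)] partition_add_cell[OF parts(1) xy(2)] parts xy
          False by (auto simp: nth_add_cell)
      moreover have "add_cell y B = add_cell x C"
        unfolding xy by (rule nth_equalityI) (simp_all add: nth_add_cell)
      then have "C = remove_cell x (add_cell y B)" by simp
      then have "commuting_square A B C (add_cell y B)"
        by (intro commuting_squareI[of y _ x]) (use xy False in auto)
      ultimately show ?thesis by (auto simp: local_rule_def dual_square_def)
    next
      case True
      \<comment> \<open>The added cell has to go to the first row of this length.\<close>
      define z where "z = Min {i. i < n \<and> B ! i = B ! x}"
      have "z \<in> {i. i < n \<and> B ! i = B ! x}"
        unfolding z_def by (rule Min_in) (use xy(1) in auto)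
      then have z: "z < n" "B ! z = B ! x" by auto
      have zmin: "z \<le> i" if "i < n" "B ! i = B ! x" for i
        using Min_le[of "{i. i < n \<and> B ! i = B ! x}" i] that by (auto simp: z_def)
      have "B ! z < B ! (z - 1)" if "0 < z"
      proof -
        have "B ! (z - 1) \<noteq> B ! x" using zmin[of "z - 1"] z(1) that by linarith
        moreover have "B ! z \<le> B ! (z - 1)" using partition_mono[OF parts(2), of "z - 1" z] z by simp
        ultimately show ?thesis using z(2) by linarith
      qed
      then have "is_partition n (add_cell z B)"
        using partition_add_cell[OF parts(2) z(1)] by blast
      moreover have "dual_square A B C (add_cell z B)"
        unfolding dual_square_def
        by (rule disjI2, intro conjI exI[of _ z] exI[of _ x]) (use xy True z in auto)
      ultimately show ?thesis by (auto simp: local_rule_def)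
    qed
  qed
qed

lemma dominant_local_rule:
  assumes "is_partition n A" "is_partition n B" "is_partition n C"
    and "differ_by_cell A B" "differ_by_cell A C"
  shows "is_partition n (dominant (vsub (vadd C B) A))"
    and "local_rule A B C (dominant (vsub (vadd C B) A))"
proof -
  obtain D where D: "is_partition n D" "local_rule A B C D"
    using local_rule_exists[OF assms] by blast
  moreover have "dominant (vsub (vadd C B) A) = D"
    using local_rule_dominant[OF assms(1-3) D] .
  ultimately show "is_partition n (dominant (vsub (vadd C B) A))"
    "local_rule A B C (dominant (vsub (vadd C B) A))" by auto
qed

section \<open>Labels of the growth diagram\<close>

lemma corner_label_diagonal: "corner_label \<omega> i i = \<omega> ! i"
  by (subst corner_label.simps) simp

lemma corner_label_near: "corner_label \<omega> i (Suc i) = smaller (\<omega> ! i) (\<omega> ! Suc i)"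
  by (subst corner_label.simps) simp

lemma corner_label_step:
  "Suc a < b \<Longrightarrow> corner_label \<omega> a b = backward_rule (corner_label \<omega> a (b - 1))
     (corner_label \<omega> (Suc a) (b - 1)) (corner_label \<omega> (Suc a) b)"
  by (subst corner_label.simps) simp

lemma corner_label_partition:
  assumes n: "n \<ge> 1" and tab: "osc_tableau n N \<mu> \<omega>" and "a \<le> b" "b \<le> N"
  shows "is_partition n (corner_label \<omega> a b) \<and> (a < b \<longrightarrow>
    weakly_covered (corner_label \<omega> a b) (corner_label \<omega> a (b - 1)) \<and>
    weakly_covered (corner_label \<omega> a b) (corner_label \<omega> (Suc a) b))"
  using assms(3,4)
proof (induction "b - a" arbitrary: a b rule: less_induct)
  case less
  have part: "is_partition n (\<omega> ! i)" if "i \<le> N" for i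
    using tab that by (simp add: osc_tableau_def)
  consider "a = b" | "b = Suc a" | "Suc a < b" using less.prems by linarith
  then show ?case
  proof cases
    case 1
    then show ?thesis using part less.prems by (simp add: corner_label_diagonal)
  next
    case 2
    then have "differ_by_cell (\<omega> ! a) (\<omega> ! Suc a)"
      using tab less.prems by (simp add: osc_tableau_def)
    then have "covered (\<omega> ! a) (\<omega> ! Suc a) \<or> covered (\<omega> ! Suc a) (\<omega> ! a)"
      by (simp add: differ_by_cell_iff)
    then show ?thesis
      using 2 part less.prems smaller_covered
      by (auto simp: corner_label_diagonal corner_label_near weakly_covered_def)
  next
    case 3
    have "Suc a \<le> b - 1" "Suc a < b" "a < b - 1" using 3 by auto
    then show ?thesis
      using less.hyps[of "b - 1" a] less.hyps[of "b - 1" "Suc a"] less.hyps[of b "Suc a"] less.prems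
        backward_rule_partition[OF n] corner_label_step[OF 3]
      by simp
  qed
qed

text \<open>The first column of labels is empty because labels decrease downwards.\<close>

lemma corner_label_left:
  assumes "n \<ge> 1" "osc_tableau n N \<mu> \<omega>" "b \<le> N"
  shows "corner_label \<omega> 0 b = empty_partition n"
  using assms(3)
proof (induction b)
  case 0
  then show ?case using assms(2) by (simp add: corner_label_diagonal osc_tableau_def)
next
  case (Suc b)
  then show ?case
    using corner_label_partition[OF assms(1,2), of 0 "Suc b"] weakly_covered_empty by simp
qed

text \<open>The last row of labels is empty because labels decrease to the left.\<close>

lemma corner_label_bottom:
  assumes "n \<ge> 1" "osc_tableau n N (empty_partition n) \<omega>" "a \<le> N"
  shows "corner_label \<omega> a N = empty_partition n"
  using assms(3)
proof (induction a rule: inc_induct)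
  case base
  then show ?case using assms(2) by (simp add: corner_label_diagonal osc_tableau_def)
next
  case (step a)
  then show ?case
    using corner_label_partition[OF assms(1,2), of a N] weakly_covered_empty by simp
qed

section \<open>Comparing the growth diagrams of two successive rows\<close>

text \<open>Here \<open>\<omega>'\<close> is the row below \<open>\<omega>\<close> in the array, and
\<open>c\<close> is the position of its only fold, or any number beyond the end of
\<open>\<omega>\<close> if there is none. The entries of \<open>\<omega>'\<close> are smaller
than those of \<open>\<omega>\<close> before the fold and larger after it.\<close>

locale promotion_row =
  fixes n N :: nat and \<mu> \<mu>' :: "int list" and \<omega> \<omega>' :: "int list list" and c :: nat
  assumes n: "n \<ge> 1"
    and tab: "osc_tableau n (Suc N) \<mu> \<omega>" and tab': "osc_tableau n N \<mu>' \<omega>'"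
    and rule: "\<And>j. 1 \<le> j \<Longrightarrow> j \<le> N \<Longrightarrow> local_rule (\<omega> ! j) (\<omega> ! Suc j) (\<omega>' ! (j - 1)) (\<omega>' ! j)"
    and c: "2 \<le> c"
    and before: "\<And>j. 1 \<le> j \<Longrightarrow> j < c \<Longrightarrow> j \<le> Suc N \<Longrightarrow> covered (\<omega>' ! (j - 1)) (\<omega> ! j)"
    and after: "\<And>j. c \<le> j \<Longrightarrow> j \<le> Suc N \<Longrightarrow> covered (\<omega> ! j) (\<omega>' ! (j - 1))"
    and at: "c \<le> Suc N \<Longrightarrow> fold_square (\<omega> ! (c - 1)) (\<omega> ! c) (\<omega>' ! (c - 2)) (\<omega>' ! (c - 1))"
begin

definition X :: "nat \<Rightarrow> nat \<Rightarrow> int list" where "X a b = corner_label \<omega> a b"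

text \<open>The shift makes the corners of the two diagrams match: \<open>\<omega>' ! (j - 1)\<close>
stands below \<open>\<omega> ! j\<close>.\<close>

definition Y :: "nat \<Rightarrow> nat \<Rightarrow> int list" where "Y a b = corner_label \<omega>' (a - 1) (b - 1)"

text \<open>The condition on the face of the cube above the edge from \<open>(a - 1, b)\<close> to
\<open>(a, b)\<close>. For \<open>b < c\<close> the labels \<open>Y\<close> are one cell
smaller than the labels \<open>X\<close>, for \<open>c \<le> a\<close> they are one cell
larger, and in between they agree; the edge crosses the boundary of a region if \<open>a =
c\<close>.\<close>

definition horizontal :: "nat \<Rightarrow> nat \<Rightarrow> bool" where
  "horizontal a b \<longleftrightarrow>
     (if b < c then jdt_face (Y (a - 1) b) (X (a - 1) b) (Y a b) (X a b)
      else if a < c then X (a - 1) b = Y (a - 1) b \<and> X a b = Y a b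
      else if a = c then X (a - 1) b = Y (a - 1) b \<and> X (a - 1) b = X a b \<and> adds_row (X a b) (Y a b)
      else dual_face (X (a - 1) b) (Y (a - 1) b) (X a b) (Y a b))"

text \<open>The condition on the face above the edge from \<open>(a, b - 1)\<close> to \<open>(a,
b)\<close>, which crosses the boundary of a region if \<open>b = c\<close>. Compared with
horizontal edges, jeu de taquin and column insertion have changed places; this reflects the
symmetry of the situation under the exchange of rows and columns, which also exchanges the two
outer regions.\<close>

definition vertical :: "nat \<Rightarrow> nat \<Rightarrow> bool" where
  "vertical a b \<longleftrightarrow>
     (if b < c then dual_face (Y a b) (X a b) (Y a (b - 1)) (X a (b - 1))
      else if b = c then Y a (b - 1) = X a b \<and> Y a b = X a b \<and> adds_row (Y a (b - 1)) (X a (b - 1))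
      else if a < c then X a (b - 1) = Y a (b - 1) \<and> X a b = Y a b
      else jdt_face (X a b) (Y a b) (X a (b - 1)) (Y a (b - 1)))"

lemma X_partition: "a \<le> b \<Longrightarrow> b \<le> Suc N \<Longrightarrow> is_partition n (X a b)"
  using corner_label_partition[OF n tab] by (simp add: X_def)

lemma Y_partition: "1 \<le> a \<Longrightarrow> a \<le> b \<Longrightarrow> b \<le> Suc N \<Longrightarrow> is_partition n (Y a b)"
  using corner_label_partition[OF n tab', of "a - 1" "b - 1"] by (simp add: Y_def)

lemma X_step: "2 \<le> a \<Longrightarrow> a < b \<Longrightarrow>
    X (a - 1) b = backward_rule (X (a - 1) (b - 1)) (X a (b - 1)) (X a b)"
  using corner_label_step[of "a - 1" b \<omega>] by (simp add: X_def)

lemma Y_step: "2 \<le> a \<Longrightarrow> a < b \<Longrightarrow>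
    Y (a - 1) b = backward_rule (Y (a - 1) (b - 1)) (Y a (b - 1)) (Y a b)"
proof -
  assume ab: "2 \<le> a" "a < b"
  then have "Suc (a - 1 - 1) = a - 1" by simp
  then show ?thesis
    using ab corner_label_step[of "a - 1 - 1" "b - 1" \<omega>'] by (simp add: Y_def)
qed

text \<open>The labels on the diagonal are the entries of \<open>\<omega>\<close> and
\<open>\<omega>'\<close>, so the local rule applies to them. Away from the fold, depending on
whether a cell is added or removed in this step, one of the two edges at the corner \<open>(i -
1, i)\<close> is trivial and the other one carries the square.\<close>

lemma edges_near_diagonal:
  assumes i: "2 \<le> i" "i \<le> Suc N"
  shows "horizontal i i \<and> vertical (i - 1) i"
proof -
  define A B C D where ABCD: "A = \<omega> ! (i - 1)" "B = \<omega> ! i" "C = \<omega>' ! (i - 2)" "D = \<omega>' ! (i - 1)"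
  have i': "i - 1 - 1 = i - 2" "Suc (i - 2) = i - 1" using i by auto
  have lr: "local_rule A B C D"
    using rule[of "i - 1"] i i' by (simp add: ABCD)
  have XA: "X (i - 1) (i - 1) = A" "X i i = B" and YC: "Y (i - 1) (i - 1) = C" "Y i i = D"
    using i' by (simp_all add: X_def Y_def ABCD corner_label_diagonal)
  have Xs: "X (i - 1) i = smaller A B"
    using corner_label_near[of \<omega> "i - 1"] i by (simp add: X_def ABCD)
  have Ys: "Y (i - 1) i = smaller C D"
    using corner_label_near[of \<omega>' "i - 2"] i' by (simp add: Y_def ABCD)
  consider "i < c" | "i = c" | "c < i" by linarith
  then show ?thesis
  proof cases
    case 1
    have cov: "covered C A" "covered D B"
      using before[of "i - 1"] before[of i] 1 i i' by (auto simp: ABCD)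
    have "jdt_square C A D B \<or> dual_square D B C A"
      using lr cov covered_asym adds_row_covered jdt_square_edges dual_square_edges
      unfolding local_rule_def fold_square_def by metis
    then show ?thesis
    proof
      assume sq: "jdt_square C A D B"
      then have "X (i - 1) i = A" "Y (i - 1) i = C"
        using smaller_covered jdt_square_edges[OF sq] Xs Ys by auto
      then show ?thesis
        using sq 1 XA YC cov by (simp add: horizontal_def vertical_def jdt_face_def dual_face_def)
    next
      assume sq: "dual_square D B C A"
      then have "X (i - 1) i = B" "Y (i - 1) i = D"
        using smaller_covered dual_square_edges[OF sq] Xs Ys by auto
      then show ?thesis
        using sq 1 XA YC cov by (simp add: horizontal_def vertical_def jdt_face_def dual_face_def)
    qed
  next
    case 2
    then have f: "B = C" "A = D" "adds_row B A"
      using at i by (auto simp: fold_square_def ABCD)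
    then have "X (i - 1) i = B" "Y (i - 1) i = B"
      using Xs Ys adds_row_covered smaller_covered by auto
    then show ?thesis using 2 XA YC f by (simp add: horizontal_def vertical_def)
  next
    case 3
    have cov: "covered A C" "covered B D"
      using after[of "i - 1"] after[of i] 3 i i' by (auto simp: ABCD)
    have "jdt_square B A D C \<or> dual_square A B C D"
      using lr cov covered_asym adds_row_covered jdt_square_edges dual_square_edges
      unfolding local_rule_def fold_square_def by metis
    then show ?thesis
    proof
      assume sq: "jdt_square B A D C"
      then have "X (i - 1) i = B" "Y (i - 1) i = D"
        using smaller_covered jdt_square_edges[OF sq] Xs Ys by auto
      then show ?thesis
        using jdt_square_commute[OF sq] 3 XA YC cov
        by (auto simp: horizontal_def vertical_def jdt_face_def dual_face_def)
    next
      assume sq: "dual_square A B C D"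
      then have "X (i - 1) i = A" "Y (i - 1) i = C"
        using smaller_covered dual_square_edges[OF sq] Xs Ys by auto
      then show ?thesis
        using dual_square_commute[OF sq] 3 XA YC cov
        by (auto simp: horizontal_def vertical_def jdt_face_def dual_face_def)
    qed
  qed
qed

text \<open>The cube lemma, in the region \<open>c \<le> a\<close> with the roles of \<open>X\<close> and
\<open>Y\<close> and of rows and columns exchanged.\<close>

lemma edges_step:
  assumes ab: "2 \<le> a" "a < b" "b \<le> Suc N"
    and top: "horizontal a (b - 1)" and right: "vertical a b"
  shows "horizontal a b \<and> vertical (a - 1) b \<and>
    (has_cross (Y (a - 1) (b - 1)) (Y a (b - 1)) (Y a b) \<longleftrightarrow>
     has_cross (X (a - 1) (b - 1)) (X a (b - 1)) (X a b))"
proof -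
  define \<kappa> \<nu> \<rho> \<kappa>' \<nu>' \<rho>' where defs: "\<kappa> = X (a - 1) (b - 1)" "\<nu> = X a b" "\<rho> = X (a - 1) b"
    "\<kappa>' = Y (a - 1) (b - 1)" "\<nu>' = Y a b" "\<rho>' = Y (a - 1) b"
  define \<tau> \<tau>' where tau: "\<tau> = X a (b - 1)" "\<tau>' = Y a (b - 1)"
  have parts: "is_partition n \<kappa>" "is_partition n \<tau>" "is_partition n \<nu>"
    and parts': "is_partition n \<kappa>'" "is_partition n \<tau>'" "is_partition n \<nu>'"
    unfolding defs tau by (rule X_partition Y_partition; use ab in linarith)+
  have r: "\<rho> = backward_rule \<kappa> \<tau> \<nu>" "\<rho>' = backward_rule \<kappa>' \<tau>' \<nu>'"
    using X_step[OF ab(1,2)] Y_step[OF ab(1,2)] by (simp_all add: defs tau)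
  note fold_defs = defs[symmetric] tau[symmetric]
  note top' = top[unfolded horizontal_def fold_defs]
  note right' = right[unfolded vertical_def fold_defs]
  consider "b < c" | "b = c" | "c < b" "a < c" | "c < b" "a = c" | "c < b" "c < a" by linarith
  then show ?thesis
  proof cases
    case 1
    have "jdt_face \<kappa>' \<kappa> \<tau>' \<tau>" "dual_face \<nu>' \<nu> \<tau>' \<tau>"
      using top' right' 1 by (auto split: if_splits)
    from backward_cube[OF n parts parts' this] show ?thesis
      unfolding horizontal_def vertical_def fold_defs using 1 r by simp
  next
    case 2
    have "jdt_face \<kappa>' \<kappa> \<tau>' \<tau>" "\<tau>' = \<nu>" "\<nu>' = \<nu>" "adds_row \<tau>' \<tau>"
      using top' right' 2 ab by (auto split: if_splits)
    with backward_fold[OF n parts(1,2) parts'(1,2)] show ?thesis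
      unfolding horizontal_def vertical_def fold_defs using 2 r ab by simp
  next
    case 3
    have "\<kappa>' = \<kappa>" "\<tau>' = \<tau>" "\<nu>' = \<nu>"
      using top' right' 3 by (auto split: if_splits)
    moreover have "a - 1 < c" using 3 by simp
    ultimately show ?thesis
      unfolding horizontal_def vertical_def fold_defs using 3 r by simp
  next
    case 4
    have eqs: "\<kappa>' = \<tau>" "\<kappa> = \<tau>" "adds_row \<tau> \<tau>'" "jdt_face \<nu> \<nu>' \<tau> \<tau>'"
      using top' right' 4 by (auto split: if_splits)
    note fold = backward_fold[OF n parts'(3,2) parts(3,2) eqs(4,3)]
    have "\<rho> = \<nu>" "\<rho>' = \<nu>" "\<not> has_cross \<kappa> \<tau> \<nu>" "\<not> has_cross \<kappa>' \<tau>' \<nu>'"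
      using fold r eqs backward_rule_commute has_cross_commute by metis+
    moreover have "a - 1 < c" using 4 ab by simp
    ultimately show ?thesis
      unfolding horizontal_def vertical_def fold_defs using 4 eqs fold by simp
  next
    case 5
    have faces: "jdt_face \<nu> \<nu>' \<tau> \<tau>'" "dual_face \<kappa> \<kappa>' \<tau> \<tau>'"
      using top' right' 5 by (auto split: if_splits)
    have "\<not> a - 1 < c" using 5 by simp
    with backward_cube[OF n parts'(3,2,1) parts(3,2,1) faces] show ?thesis
      unfolding horizontal_def vertical_def fold_defs
      using 5 r backward_rule_commute[of \<nu>] backward_rule_commute[of \<nu>'] has_cross_commute[of \<nu>]
        has_cross_commute[of \<nu>'] by auto
  qed
qed

lemma edges: "2 \<le> a \<Longrightarrow> a \<le> b \<Longrightarrow> b \<le> Suc N \<Longrightarrow> horizontal a b \<and> vertical (a - 1) b"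
proof (induction "b - a" arbitrary: a b)
  case 0
  then show ?case using edges_near_diagonal[of a] by simp
next
  case (Suc d)
  have "horizontal a (b - 1)" using Suc.hyps(1)[of "b - 1" a] Suc.hyps(2) Suc.prems by simp
  moreover have "vertical a b" using Suc.hyps(1)[of b "Suc a"] Suc.hyps(2) Suc.prems by simp
  ultimately show ?case using edges_step[of a b] Suc.hyps(2) Suc.prems by simp
qed

lemma cell_cross_shift:
  assumes "2 \<le> a" "a < b" "b \<le> Suc N"
  shows "cell_cross \<omega> a b \<longleftrightarrow> cell_cross \<omega>' (a - 1) (b - 1)"
proof -
  have "horizontal a (b - 1)" "vertical a b"
    using edges[of a "b - 1"] edges[of "Suc a" b] assms by auto
  from edges_step[OF assms this] show ?thesis
    unfolding cell_cross_def X_def Y_def by auto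
qed

text \<open>In the first column, \<open>Y\<close> is empty. So \<open>X 1 b\<close> is a single cell for
\<open>b < c\<close> and empty from \<open>c\<close> on, and the cross is where the cell
disappears.\<close>

lemma cell_cross_first_column:
  assumes b: "2 \<le> b" "b \<le> Suc N"
  shows "cell_cross \<omega> 1 b \<longleftrightarrow> b = c"
proof -
  let ?e = "empty_partition n"
  have Y: "Y 1 b = ?e" "Y 1 (b - 1) = ?e"
    using corner_label_left[OF n tab'] b by (simp_all add: Y_def)
  have "corner_label \<omega> 0 b = ?e" "corner_label \<omega> 0 (b - 1) = ?e"
    using corner_label_left[OF n tab] b by auto
  then have cross: "cell_cross \<omega> 1 b \<longleftrightarrow> X 1 b = ?e \<and> X 1 (b - 1) = add_cell 0 ?e"
    by (auto simp: cell_cross_def has_cross_def X_def)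
  have V: "vertical 1 b" using edges[of 2 b] b by simp
  consider "b < c" | "b = c" | "c < b" by linarith
  then show ?thesis
  proof cases
    case 1
    then have "covered (Y 1 b) (X 1 b)"
      using V dual_face_covered by (auto simp: vertical_def)
    then show ?thesis using 1 cross Y covered_irrefl by auto
  next
    case 2
    then have e: "X 1 b = ?e" "adds_row ?e (X 1 (b - 1))"
      using V Y by (auto simp: vertical_def)
    have "is_partition n (X 1 (b - 1))" by (rule X_partition) (use b in auto)
    then have "X 1 (b - 1) = add_cell 0 ?e" using e adds_row_covered covered_empty by blast
    then show ?thesis using 2 e cross by simp
  next
    case 3
    then have "X 1 (b - 1) = ?e" using V Y c by (simp add: vertical_def)
    moreover have "?e \<noteq> add_cell 0 ?e" using n by (auto simp: add_cell_eq_iff empty_partition_def)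
    ultimately show ?thesis using 3 cross by auto
  qed
qed

text \<open>If \<open>\<omega>\<close> has empty shape, the labels \<open>X\<close> in the last row are
empty, so the labels \<open>Y\<close> are nonempty exactly in the region where they exceed
\<open>X\<close>.\<close>

lemma last_row_label:
  assumes "\<mu> = empty_partition n" "1 \<le> a" "a \<le> Suc N"
  shows "c \<le> Suc N" "corner_label \<omega>' (a - 1) N = empty_partition n \<longleftrightarrow> a < c"
proof -
  let ?e = "empty_partition n"
  show cN: "c \<le> Suc N"
  proof (rule ccontr)
    assume "\<not> c \<le> Suc N"
    then have "covered (\<omega>' ! N) (\<omega> ! Suc N)" using before[of "Suc N"] by simp
    moreover have "\<omega> ! Suc N = ?e" "is_partition n (\<omega>' ! N)"
      using tab tab' assms(1) by (auto simp: osc_tableau_def)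
    ultimately have "\<omega>' ! N = ?e" "covered (\<omega>' ! N) ?e"
      using weakly_covered_empty by (auto simp: weakly_covered_def)
    then show False using covered_irrefl by auto
  qed
  have X: "X a (Suc N) = ?e" using corner_label_bottom[OF n] tab assms by (simp add: X_def)
  have Y: "Y a (Suc N) = corner_label \<omega>' (a - 1) N" by (simp add: Y_def)
  show "corner_label \<omega>' (a - 1) N = ?e \<longleftrightarrow> a < c"
  proof (cases "a = 1")
    case True
    then show ?thesis using corner_label_left[OF n tab'] c by simp
  next
    case False
    then have H: "horizontal a (Suc N)" using edges[of a "Suc N"] assms by simp
    consider "a < c" | "a = c" | "c < a" by linarith
    then show ?thesis
    proof cases
      case 1
      then show ?thesis using H X Y cN by (simp add: horizontal_def)
    next
      case 2
      then have "covered ?e (Y a (Suc N))"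
        using H X cN adds_row_covered by (simp add: horizontal_def)
      then show ?thesis using 2 Y covered_irrefl by auto
    next
      case 3
      then have "covered ?e (Y a (Suc N))"
        using H X cN dual_face_covered by (auto simp: horizontal_def)
      then show ?thesis using 3 Y covered_irrefl by auto
    qed
  qed
qed

end

text \<open>The row \<open>\<omega>'\<close> starts below \<open>\<omega>\<close>. Unfolded squares
preserve the direction of the inclusion, a fold reverses it, and a fold can only happen while
\<open>\<omega>'\<close> is smaller; so there is at most one.\<close>

lemma fold_position_exists:
  assumes n: "n \<ge> 1" and tab: "osc_tableau n (Suc N) \<mu> \<omega>" and tab': "osc_tableau n N \<mu>' \<omega>'"
    and rule: "\<And>j. 1 \<le> j \<Longrightarrow> j \<le> N \<Longrightarrow> local_rule (\<omega> ! j) (\<omega> ! Suc j) (\<omega>' ! (j - 1)) (\<omega>' ! j)"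
  obtains c where "promotion_row n N \<mu> \<mu>' \<omega> \<omega>' c"
    and "\<And>j. 2 \<le> j \<Longrightarrow> j \<le> Suc N \<Longrightarrow>
      fold_square (\<omega> ! (j - 1)) (\<omega> ! j) (\<omega>' ! (j - 2)) (\<omega>' ! (j - 1)) \<longleftrightarrow> j = c"
proof -
  let ?fold = "\<lambda>j. fold_square (\<omega> ! (j - 1)) (\<omega> ! j) (\<omega>' ! (j - 2)) (\<omega>' ! (j - 1))"
  \<comment> \<open>If there is no fold, this is the first index beyond the end of \<omega>.\<close>
  define c where "c = (LEAST j. 2 \<le> j \<and> (j \<le> Suc N \<longrightarrow> ?fold j))"
  have "2 \<le> Suc (Suc N) \<and> (Suc (Suc N) \<le> Suc N \<longrightarrow> ?fold (Suc (Suc N)))" by simp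
  from LeastI[where P = "\<lambda>j. 2 \<le> j \<and> (j \<le> Suc N \<longrightarrow> ?fold j)", OF this]
  have c: "2 \<le> c" "c \<le> Suc N \<Longrightarrow> ?fold c" by (auto simp: c_def)
  have least: "\<not> ?fold j" if "2 \<le> j" "j < c" "j \<le> Suc N" for j
    using not_less_Least[of j "\<lambda>j. 2 \<le> j \<and> (j \<le> Suc N \<longrightarrow> ?fold j)"] that
    by (auto simp: c_def)
  have empty: "\<omega>' ! 0 = empty_partition n" "\<omega> ! 0 = empty_partition n"
    using tab tab' by (simp_all add: osc_tableau_def)
  have start: "covered (\<omega>' ! 0) (\<omega> ! 1)"
  proof -
    have d: "differ_by_cell (\<omega> ! 0) (\<omega> ! 1)" and p: "is_partition n (\<omega> ! 1)"
      using tab by (auto simp: osc_tableau_def)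
    then have "covered (\<omega> ! 0) (\<omega> ! 1) \<or> covered (\<omega> ! 1) (\<omega> ! 0)"
      by (simp add: differ_by_cell_iff)
    moreover have "\<not> covered (\<omega> ! 1) (\<omega> ! 0)"
      using weakly_covered_empty[OF p] covered_irrefl empty by (auto simp: weakly_covered_def)
    ultimately show ?thesis using empty by simp
  qed
  have before: "covered (\<omega>' ! (j - 1)) (\<omega> ! j)" if "1 \<le> j" "j < c" "j \<le> Suc N" for j
    using that
  proof (induction j rule: dec_induct)
    case base
    then show ?case using start by simp
  next
    case (step j)
    have cov: "covered (\<omega>' ! (j - 1)) (\<omega> ! j)" using step by simp
    have lr: "local_rule (\<omega> ! j) (\<omega> ! Suc j) (\<omega>' ! (j - 1)) (\<omega>' ! j)" using rule step by simp
    have nf: "\<not> fold_square (\<omega> ! j) (\<omega> ! Suc j) (\<omega>' ! (j - 1)) (\<omega>' ! j)"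
      using least[of "Suc j"] step by (simp add: numeral_2_eq_2)
    have "\<not> covered (\<omega> ! j) (\<omega>' ! (j - 1))" using covered_asym[OF cov] .
    then have "covered (\<omega>' ! j) (\<omega> ! Suc j)"
      using lr nf unfolding local_rule_def
      by (auto dest: jdt_square_edges dual_square_edges)
    then show ?case by simp
  qed
  have after: "covered (\<omega> ! j) (\<omega>' ! (j - 1))" if "c \<le> j" "j \<le> Suc N" for j
    using that
  proof (induction j rule: dec_induct)
    case base
    then show ?case using c adds_row_covered by (auto simp: fold_square_def)
  next
    case (step j)
    have cov: "covered (\<omega> ! j) (\<omega>' ! (j - 1))" using step by simp
    have lr: "local_rule (\<omega> ! j) (\<omega> ! Suc j) (\<omega>' ! (j - 1)) (\<omega>' ! j)" using rule step c by simp
    have "\<not> covered (\<omega>' ! (j - 1)) (\<omega> ! j)" using covered_asym[OF cov] .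
    then have "covered (\<omega> ! Suc j) (\<omega>' ! j)"
      using lr adds_row_covered unfolding local_rule_def fold_square_def
      by (auto dest: jdt_square_edges dual_square_edges)
    then show ?case by simp
  qed
  have row: "promotion_row n N \<mu> \<mu>' \<omega> \<omega>' c"
    by unfold_locales (use n tab tab' rule c before after in auto)
  have "?fold j \<longleftrightarrow> j = c" if j: "2 \<le> j" "j \<le> Suc N" for j
  proof
    assume f: "?fold j"
    show "j = c"
    proof (rule ccontr)
      assume "j \<noteq> c"
      then consider "j < c" | "c < j" by linarith
      then show False
      proof cases
        case 1
        then show False using least f j by blast
      next
        case 2
        then have "covered (\<omega> ! (j - 1)) (\<omega>' ! (j - 2))"
          using after[of "j - 1"] j by (simp add: numeral_2_eq_2)
        then show False using f adds_row_covered covered_asym by (auto simp: fold_square_def)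
      qed
    qed
  qed (use c j in auto)
  with row show thesis by (rule that)
qed

section \<open>Crosses are folds of the evacuation array\<close>

lemma evac_entry_diagonal:
  assumes "osc_tableau n r \<mu> \<omega>"
  shows "evac_entry n \<omega> k k = empty_partition n"
  using assms by (cases k) (auto simp: osc_tableau_def)

lemma evac_entry_step:
  "k < j \<Longrightarrow> evac_entry n \<omega> (Suc k) (Suc j) =
    dominant (vsub (vadd (evac_entry n \<omega> (Suc k) j) (evac_entry n \<omega> k (Suc j))) (evac_entry n \<omega> k j))"
  by simp

declare evac_entry.simps(3) [simp del]

lemma evac_row_step:
  assumes tab: "osc_tableau n r \<mu> \<omega>"
    and row: "\<And>j. k \<le> j \<Longrightarrow> j \<le> r \<Longrightarrow> is_partition n (evac_entry n \<omega> k j)"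
      "\<And>j. k \<le> j \<Longrightarrow> j < r \<Longrightarrow> differ_by_cell (evac_entry n \<omega> k j) (evac_entry n \<omega> k (Suc j))"
    and j: "Suc k \<le> j" "j \<le> r"
  shows "is_partition n (evac_entry n \<omega> (Suc k) j) \<and>
    differ_by_cell (evac_entry n \<omega> k j) (evac_entry n \<omega> (Suc k) j) \<and>
    (j < r \<longrightarrow> local_rule (evac_entry n \<omega> k j) (evac_entry n \<omega> k (Suc j))
      (evac_entry n \<omega> (Suc k) j) (evac_entry n \<omega> (Suc k) (Suc j)))"
proof -
  let ?T = "evac_entry n \<omega>"
  have square: "is_partition n (?T (Suc k) (Suc j)) \<and>
      local_rule (?T k j) (?T k (Suc j)) (?T (Suc k) j) (?T (Suc k) (Suc j))"
    if "Suc k \<le> j" "j < r" "is_partition n (?T (Suc k) j)" "differ_by_cell (?T k j) (?T (Suc k) j)"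
    for j
  proof -
    have "is_partition n (?T k j)" "is_partition n (?T k (Suc j))"
      "differ_by_cell (?T k j) (?T k (Suc j))"
      using row that(1,2) by simp_all
    from dominant_local_rule[OF this(1,2) that(3) this(3) that(4)] show ?thesis
      using evac_entry_step[of k j n \<omega>] that(1) by simp
  qed
  have "is_partition n (?T (Suc k) j) \<and> differ_by_cell (?T k j) (?T (Suc k) j)"
    using j
  proof (induction j rule: dec_induct)
    case base
    have "differ_by_cell (?T k k) (?T k (Suc k))" using row(2)[of k] base by simp
    then show ?case
      using evac_entry_diagonal[OF tab] is_partition_empty differ_by_cell_sym by simp
  next
    case (step j)
    then have "is_partition n (?T (Suc k) (Suc j))"
      "local_rule (?T k j) (?T k (Suc j)) (?T (Suc k) j) (?T (Suc k) (Suc j))"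
      using square[of j] by simp_all
    then show ?case using local_rule_adjacent by blast
  qed
  then show ?thesis using square[of j] j by simp
qed

lemma evac_row:
  assumes tab: "osc_tableau n r \<mu> \<omega>" and "k \<le> r"
  shows "(\<forall>j. k \<le> j \<longrightarrow> j \<le> r \<longrightarrow> is_partition n (evac_entry n \<omega> k j)) \<and>
    (\<forall>j. k \<le> j \<longrightarrow> j < r \<longrightarrow> differ_by_cell (evac_entry n \<omega> k j) (evac_entry n \<omega> k (Suc j)))"
  using assms(2)
proof (induction k)
  case 0
  then show ?case using tab by (simp add: osc_tableau_def)
next
  case (Suc k)
  then have row: "\<And>j. k \<le> j \<Longrightarrow> j \<le> r \<Longrightarrow> is_partition n (evac_entry n \<omega> k j)"
    "\<And>j. k \<le> j \<Longrightarrow> j < r \<Longrightarrow> differ_by_cell (evac_entry n \<omega> k j) (evac_entry n \<omega> k (Suc j))"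
    by auto
  note step = evac_row_step[OF tab row]
  show ?case
  proof (intro conjI allI impI)
    show "is_partition n (evac_entry n \<omega> (Suc k) j)" if "Suc k \<le> j" "j \<le> r" for j
      using step[of j] that by simp
    show "differ_by_cell (evac_entry n \<omega> (Suc k) j) (evac_entry n \<omega> (Suc k) (Suc j))"
      if "Suc k \<le> j" "j < r" for j
      using step[of j] that local_rule_adjacent(2) by auto
  qed
qed

lemma evac_partition:
  assumes "osc_tableau n r \<mu> \<omega>" "k \<le> j" "j \<le> r"
  shows "is_partition n (evac_entry n \<omega> k j)"
  using evac_row[OF assms(1), of k] assms by simp

lemma evac_horizontal:
  assumes "osc_tableau n r \<mu> \<omega>" "k \<le> j" "j < r"
  shows "differ_by_cell (evac_entry n \<omega> k j) (evac_entry n \<omega> k (Suc j))"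
  using evac_row[OF assms(1), of k] assms by simp

lemma evac_vertical:
  assumes "osc_tableau n r \<mu> \<omega>" "k < j" "j \<le> r"
  shows "differ_by_cell (evac_entry n \<omega> k j) (evac_entry n \<omega> (Suc k) j)"
  using evac_row_step[OF assms(1) evac_partition[OF assms(1)] evac_horizontal[OF assms(1)], of k j]
    assms by simp

lemma evac_local_rule:
  assumes "osc_tableau n r \<mu> \<omega>" "k < j" "j < r"
  shows "local_rule (evac_entry n \<omega> k j) (evac_entry n \<omega> k (Suc j))
      (evac_entry n \<omega> (Suc k) j) (evac_entry n \<omega> (Suc k) (Suc j))"
  using evac_row_step[OF assms(1) evac_partition[OF assms(1)] evac_horizontal[OF assms(1)], of k j]
    assms by simp

text \<open>Row \<open>k\<close> of the array is again an oscillating tableau, which permits induction on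
rows.\<close>

definition evac_list :: "nat \<Rightarrow> nat \<Rightarrow> int list list \<Rightarrow> nat \<Rightarrow> int list list" where
  "evac_list n r \<omega> k = map (evac_entry n \<omega> k) [k..<Suc r]"

lemma length_evac_list [simp]: "length (evac_list n r \<omega> k) = Suc r - k"
  by (simp add: evac_list_def del: upt_Suc)

lemma nth_evac_list: "k + i \<le> r \<Longrightarrow> evac_list n r \<omega> k ! i = evac_entry n \<omega> k (k + i)"
  by (simp add: evac_list_def del: upt_Suc)

lemma evac_list_0:
  assumes "osc_tableau n r \<mu> \<omega>"
  shows "evac_list n r \<omega> 0 = \<omega>"
  by (rule nth_equalityI) (use assms in \<open>auto simp: nth_evac_list osc_tableau_def\<close>)

lemma evac_list_tableau:
  assumes "osc_tableau n r \<mu> \<omega>" "k \<le> r"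
  shows "osc_tableau n (r - k) (evac_entry n \<omega> k r) (evac_list n r \<omega> k)"
  using assms evac_partition[OF assms(1)] evac_horizontal[OF assms(1)] evac_entry_diagonal[OF assms(1)]
  unfolding osc_tableau_def[of n "r - k"] by (auto simp: nth_evac_list Suc_diff_le)

definition evac_fold :: "nat \<Rightarrow> int list list \<Rightarrow> nat \<Rightarrow> nat \<Rightarrow> bool" where
  "evac_fold n \<omega> i j \<longleftrightarrow> fold_square (evac_entry n \<omega> (i - 1) (j - 1)) (evac_entry n \<omega> (i - 1) j)
     (evac_entry n \<omega> i (j - 1)) (evac_entry n \<omega> i j)"

lemma evac_promotion_row:
  assumes n: "n \<ge> 1" and tab: "osc_tableau n r \<mu> \<omega>" and k: "k < r"
  obtains c where "promotion_row n (r - Suc k) (evac_entry n \<omega> k r) (evac_entry n \<omega> (Suc k) r)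
      (evac_list n r \<omega> k) (evac_list n r \<omega> (Suc k)) c"
    and "\<And>j. 2 \<le> j \<Longrightarrow> k + j \<le> r \<Longrightarrow> evac_fold n \<omega> (Suc k) (k + j) \<longleftrightarrow> j = c"
proof -
  have S: "Suc (r - Suc k) = r - k" using k by simp
  have tabs: "osc_tableau n (Suc (r - Suc k)) (evac_entry n \<omega> k r) (evac_list n r \<omega> k)"
    "osc_tableau n (r - Suc k) (evac_entry n \<omega> (Suc k) r) (evac_list n r \<omega> (Suc k))"
    using evac_list_tableau[OF tab] k S by simp_all
  have rule: "local_rule (evac_list n r \<omega> k ! j) (evac_list n r \<omega> k ! Suc j)
      (evac_list n r \<omega> (Suc k) ! (j - 1)) (evac_list n r \<omega> (Suc k) ! j)"
    if "1 \<le> j" "j \<le> r - Suc k" for j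
  proof -
    have "k + Suc j \<le> r" "Suc k + (j - 1) = k + j" using that k by auto
    then show ?thesis
      using evac_local_rule[OF tab, of k "k + j"] that by (simp add: nth_evac_list)
  qed
  obtain c where c: "promotion_row n (r - Suc k) (evac_entry n \<omega> k r) (evac_entry n \<omega> (Suc k) r)
      (evac_list n r \<omega> k) (evac_list n r \<omega> (Suc k)) c"
    and f: "\<And>j. 2 \<le> j \<Longrightarrow> j \<le> Suc (r - Suc k) \<Longrightarrow>
      fold_square (evac_list n r \<omega> k ! (j - 1)) (evac_list n r \<omega> k ! j)
        (evac_list n r \<omega> (Suc k) ! (j - 2)) (evac_list n r \<omega> (Suc k) ! (j - 1)) \<longleftrightarrow> j = c"
    using fold_position_exists[OF n tabs rule] by blast
  have "evac_fold n \<omega> (Suc k) (k + j) \<longleftrightarrow> j = c" if j: "2 \<le> j" "k + j \<le> r" for j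
  proof -
    have "Suc (k + (j - 2)) = k + j - 1" "Suc (k + (j - 1)) = k + j" "k + (j - 1) = k + j - 1"
      using j by auto
    then show ?thesis using f[of j] j k by (simp add: evac_fold_def nth_evac_list)
  qed
  with c show thesis by (rule that)
qed

text \<open>The first column of the growth diagram records the fold of the first row of the array, and the
crosses in the other columns are those of the next row.\<close>

lemma cell_cross_evac_fold:
  assumes n: "n \<ge> 1" and tab: "osc_tableau n r \<mu> \<omega>"
  shows "1 \<le> i \<Longrightarrow> i < j \<Longrightarrow> k + j \<le> r \<Longrightarrow>
    cell_cross (evac_list n r \<omega> k) i j \<longleftrightarrow> evac_fold n \<omega> (k + i) (k + j)"
proof (induction i arbitrary: j k rule: dec_induct)
  case base
  obtain c where c: "promotion_row n (r - Suc k) (evac_entry n \<omega> k r) (evac_entry n \<omega> (Suc k) r)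
      (evac_list n r \<omega> k) (evac_list n r \<omega> (Suc k)) c"
    "\<And>j. 2 \<le> j \<Longrightarrow> k + j \<le> r \<Longrightarrow> evac_fold n \<omega> (Suc k) (k + j) \<longleftrightarrow> j = c"
    using evac_promotion_row[OF n tab, of k] base by auto
  then show ?case
    using promotion_row.cell_cross_first_column[OF c(1), of j] base by auto
next
  case (step i)
  have "k < r" using step by simp
  then obtain c where c: "promotion_row n (r - Suc k) (evac_entry n \<omega> k r)
      (evac_entry n \<omega> (Suc k) r) (evac_list n r \<omega> k) (evac_list n r \<omega> (Suc k)) c"
    using evac_promotion_row[OF n tab] by blast
  have "cell_cross (evac_list n r \<omega> k) (Suc i) j \<longleftrightarrow> cell_cross (evac_list n r \<omega> (Suc k)) i (j - 1)"
    using promotion_row.cell_cross_shift[OF c, of "Suc i" j] step by auto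
  also have "\<dots> \<longleftrightarrow> evac_fold n \<omega> (Suc k + i) (Suc k + (j - 1))"
    using step by (intro step.IH) auto
  finally show ?case using step by simp
qed

lemma cell_cross_iff_evac_fold:
  assumes "n \<ge> 1" "osc_tableau n r \<mu> \<omega>" "1 \<le> i" "i < j" "j \<le> r"
  shows "cell_cross \<omega> i j \<longleftrightarrow> evac_fold n \<omega> i j"
  using cell_cross_evac_fold[OF assms(1-4), of 0] assms evac_list_0[OF assms(2)] by simp

section \<open>Evacuation and reversal\<close>

text \<open>The reflected array has the right first row and diagonal, and it obeys the local rule because
that rule is symmetric.\<close>

lemma evac_entry_evacuation:
  assumes tab: "osc_tableau n r (empty_partition n) \<omega>"
  shows "k \<le> j \<Longrightarrow> j \<le> r \<Longrightarrow>
    evac_entry n (evacuation n r \<omega>) k j = evac_entry n \<omega> (r - j) (r - k)"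
proof (induction k arbitrary: j)
  case 0
  then show ?case by (simp add: evacuation_def del: upt_Suc)
next
  case (Suc k)
  have IH: "evac_entry n (evacuation n r \<omega>) k j = evac_entry n \<omega> (r - j) (r - k)"
    if "k \<le> j" "j \<le> r" for j using Suc.IH that .
  show ?case
    using Suc.prems
  proof (induction j rule: dec_induct)
    case base
    then show ?case using evac_entry_diagonal[OF tab] by (simp add: evac_entry.simps(3))
  next
    case (step j)
    \<comment> \<open>The square of the reflected array is the square of the original one at p and q, read from its
      bottom-right corner to its top-left corner.\<close>
    define p q where pq: "p = r - Suc j" "q = r - Suc k"
    have eq: "r - j = Suc p" "r - k = Suc q" "p < q" "q < r" using step by (auto simp: pq)
    have rule: "local_rule (evac_entry n \<omega> (Suc p) (Suc q)) (evac_entry n \<omega> p (Suc q))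
        (evac_entry n \<omega> (Suc p) q) (evac_entry n \<omega> p q)"
      using local_rule_reverse[OF evac_local_rule[OF tab eq(3,4)]] .
    have "evac_entry n (evacuation n r \<omega>) (Suc k) (Suc j) = dominant (vsub (vadd
        (evac_entry n \<omega> (Suc p) q) (evac_entry n \<omega> p (Suc q))) (evac_entry n \<omega> (Suc p) (Suc q)))"
      using evac_entry_step[of k j n "evacuation n r \<omega>"] step IH[of j] IH[of "Suc j"] eq
      by (simp add: pq)
    also have "\<dots> = evac_entry n \<omega> p q"
      by (rule local_rule_dominant[OF _ _ _ _ rule]; rule evac_partition[OF tab]; use eq in simp)
    finally show ?case by (simp add: pq)
  qed
qed

lemma evacuation_tableau:
  assumes tab: "osc_tableau n r (empty_partition n) \<omega>"
  shows "osc_tableau n r (empty_partition n) (evacuation n r \<omega>)"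
  unfolding osc_tableau_def
proof (intro conjI allI impI)
  have nth: "evacuation n r \<omega> ! i = evac_entry n \<omega> (r - i) r" if "i \<le> r" for i
    using that by (simp add: evacuation_def del: upt_Suc)
  show "length (evacuation n r \<omega>) = r + 1" by (simp add: evacuation_def)
  show "is_partition n (evacuation n r \<omega> ! i)" if "i \<le> r" for i
    using nth evac_partition[OF tab] that by simp
  show "evacuation n r \<omega> ! 0 = empty_partition n"
    using nth evac_entry_diagonal[OF tab] by simp
  show "evacuation n r \<omega> ! r = empty_partition n"
    using nth tab by (simp add: osc_tableau_def)
  show "differ_by_cell (evacuation n r \<omega> ! i) (evacuation n r \<omega> ! Suc i)" if "i < r" for i
    using nth[of i] nth[of "Suc i"] evac_vertical[OF tab, of "r - Suc i" r] that differ_by_cell_sym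
    by (simp add: Suc_diff_Suc)
qed

lemma evac_fold_evacuation:
  assumes "osc_tableau n r (empty_partition n) \<omega>" "1 \<le> i" "i < j" "j \<le> r"
  shows "evac_fold n (evacuation n r \<omega>) i j \<longleftrightarrow> evac_fold n \<omega> (r + 1 - j) (r + 1 - i)"
proof -
  have eq: "r - (j - 1) = r + 1 - j" "r - (i - 1) = r + 1 - i" "r + 1 - j - 1 = r - j"
    "r + 1 - i - 1 = r - i" using assms by auto
  show ?thesis
    unfolding evac_fold_def
    using assms eq fold_square_reverse evac_entry_evacuation[OF assms(1)] by simp
qed

lemma cell_cross_evacuation:
  assumes "n \<ge> 1" "osc_tableau n r (empty_partition n) \<omega>" "1 \<le> i" "i < j" "j \<le> r"
  shows "cell_cross (evacuation n r \<omega>) i j \<longleftrightarrow> cell_cross \<omega> (r + 1 - j) (r + 1 - i)"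
proof -
  have "1 \<le> r + 1 - j" "r + 1 - j < r + 1 - i" "r + 1 - i \<le> r" using assms by auto
  then show ?thesis
    using cell_cross_iff_evac_fold[OF assms(1) evacuation_tableau[OF assms(2)] assms(3-5)]
      cell_cross_iff_evac_fold[OF assms(1,2)] evac_fold_evacuation[OF assms(2-5)] by simp
qed

lemma reverse_matching_evacuation:
  assumes "n \<ge> 1" "osc_tableau n r (empty_partition n) \<omega>"
  shows "reverse_matching r (sundaram r \<omega>) = sundaram r (evacuation n r \<omega>)"
proof (intro equalityI subsetI)
  fix p assume "p \<in> reverse_matching r (sundaram r \<omega>)"
  then obtain i j where ij: "1 \<le> i" "i < j" "j \<le> r" "cell_cross \<omega> i j"
    and p: "p = {r + 1 - j, r + 1 - i}"
    by (auto simp: reverse_matching_def sundaram_def)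
  let ?i = "r + 1 - j" and ?j = "r + 1 - i"
  have *: "1 \<le> ?i" "?i < ?j" "?j \<le> r" using ij by auto
  have "cell_cross (evacuation n r \<omega>) ?i ?j"
    using cell_cross_evacuation[OF assms *] ij by simp
  then show "p \<in> sundaram r (evacuation n r \<omega>)" unfolding p sundaram_def using * by blast
next
  fix p assume "p \<in> sundaram r (evacuation n r \<omega>)"
  then obtain i j where ij: "1 \<le> i" "i < j" "j \<le> r" "cell_cross (evacuation n r \<omega>) i j"
    and p: "p = {i, j}"
    by (auto simp: sundaram_def)
  let ?i = "r + 1 - j" and ?j = "r + 1 - i"
  have *: "1 \<le> ?i" "?i < ?j" "?j \<le> r" using ij by auto
  have "cell_cross \<omega> ?i ?j" using cell_cross_evacuation[OF assms ij(1-3)] ij by simp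
  then have "{?i, ?j} \<in> sundaram r \<omega>" unfolding sundaram_def using * by blast
  moreover have "p = (\<lambda>i. r + 1 - i) ` {?i, ?j}" using p ij by auto
  ultimately show "p \<in> reverse_matching r (sundaram r \<omega>)" unfolding reverse_matching_def by blast
qed

section \<open>Promotion and rotation\<close>

text \<open>A label depends only on the entries of the tableau between its two coordinates; hence the final
entry of a promotion affects only the last row of its growth diagram.\<close>

lemma corner_label_append:
  "a < length \<omega> \<Longrightarrow> b < length \<omega> \<Longrightarrow> corner_label (\<omega> @ \<omega>') a b = corner_label \<omega> a b"
proof (induction "b - a" arbitrary: a b rule: less_induct)
  case less
  consider "b \<le> a" | "b = Suc a" | "Suc a < b" by linarith
  then show ?case
  proof cases
    case 1
    then show ?thesis
      using less.prems by (simp add: corner_label.simps[of _ a b] nth_append)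
  next
    case 2
    then show ?thesis using less.prems by (simp add: corner_label_near nth_append)
  next
    case 3
    then show ?thesis
      using less.hyps[of "b - 1" a] less.hyps[of "b - 1" "Suc a"] less.hyps[of b "Suc a"] less.prems
      by (simp add: corner_label_step[OF 3])
  qed
qed

lemma cell_cross_append:
  "i < j \<Longrightarrow> j < length \<omega> \<Longrightarrow> cell_cross (\<omega> @ \<omega>') i j \<longleftrightarrow> cell_cross \<omega> i j"
  by (simp add: cell_cross_def corner_label_append)

lemma promotion_entry_evac:
  assumes "osc_tableau n r \<mu> \<omega>"
  shows "promotion_entry n \<omega> k = evac_entry n \<omega> 1 (Suc k)"
proof (induction k)
  case 0
  then show ?case using evac_entry_diagonal[OF assms, of 1] by simp
next
  case (Suc k)
  then show ?case using evac_entry_step[of 0 "Suc k" n \<omega>] by simp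
qed

lemma promotion_evac_list:
  assumes "osc_tableau n r \<mu> \<omega>"
  shows "promotion n r \<omega> = evac_list n r \<omega> 1 @ [\<mu>]"
proof -
  have "map (promotion_entry n \<omega>) [0..<r] = evac_list n r \<omega> 1"
    by (rule nth_equalityI) (simp_all add: nth_evac_list promotion_entry_evac[OF assms])
  then show ?thesis using assms by (simp add: promotion_def osc_tableau_def)
qed

lemma promotion_tableau:
  assumes tab: "osc_tableau n r \<mu> \<omega>" and r: "0 < r"
  shows "osc_tableau n r \<mu> (promotion n r \<omega>)"
proof -
  have row: "osc_tableau n (r - 1) (evac_entry n \<omega> 1 r) (evac_list n r \<omega> 1)"
    using evac_list_tableau[OF tab, of 1] r by simp
  have last: "differ_by_cell (evac_entry n \<omega> 1 r) \<mu>" "is_partition n \<mu>"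
    using evac_vertical[OF tab, of 0 r] tab r differ_by_cell_sym by (auto simp: osc_tableau_def)
  obtain N where N: "r = Suc N" using r by (cases r) auto
  show ?thesis
    unfolding promotion_evac_list[OF tab]
    using row last unfolding N by (auto simp: osc_tableau_def nth_append less_Suc_eq le_Suc_eq)
qed

text \<open>All pairs of \<open>\<omega>\<close> without the point 1 come from pairs of the promotion
without the point \<open>r\<close>. The point 1 is matched with \<open>c\<close>, and the last
row of labels shows that \<open>r\<close> is matched with \<open>c - 1\<close> in the
promotion.\<close>

lemma rotate_matching_promotion:
  assumes n: "n \<ge> 1" and tab: "osc_tableau n r (empty_partition n) \<omega>" and r: "0 < r"
  shows "rotate_matching r (sundaram r (promotion n r \<omega>)) = sundaram r \<omega>"
proof -
  let ?e = "empty_partition n" and ?pr = "promotion n r \<omega>" and ?row = "evac_list n r \<omega> 1"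
  obtain c where c: "promotion_row n (r - Suc 0) (evac_entry n \<omega> 0 r) (evac_entry n \<omega> (Suc 0) r)
      (evac_list n r \<omega> 0) (evac_list n r \<omega> (Suc 0)) c"
    using evac_promotion_row[OF n tab r] by blast
  interpret row: promotion_row n "r - 1" ?e "evac_entry n \<omega> 1 r" \<omega> ?row c
    using c evac_list_0[OF tab] tab by (simp add: osc_tableau_def)
  have pr: "?pr = ?row @ [?e]" using promotion_evac_list[OF tab] .
  have pr_tab: "osc_tableau n r ?e ?pr" using promotion_tableau[OF tab r] .
  have cr: "c \<le> r" using row.last_row_label(1)[of 1] r by simp
  have inner: "cell_cross \<omega> (Suc i) (Suc j) \<longleftrightarrow> cell_cross ?pr i j" if "1 \<le> i" "i < j" "j < r" for i j
    using row.cell_cross_shift[of "Suc i" "Suc j"] cell_cross_append[of i j ?row "[?e]"] that pr by simp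
  have outer: "cell_cross ?pr x r \<longleftrightarrow> Suc x = c" if x: "1 \<le> x" "x < r" for x
  proof -
    have lab: "corner_label ?pr a (r - 1) = corner_label ?row a (r - 1)" if "a < r" for a
      using corner_label_append[of a ?row "r - 1" "[?e]"] that r pr by simp
    have e: "corner_label ?pr x r = ?e" using corner_label_bottom[OF n pr_tab] x by simp
    have kap: "corner_label ?pr (x - 1) (r - 1) = ?e \<longleftrightarrow> x < c"
      using row.last_row_label(2)[of x] lab[of "x - 1"] x by simp
    have mu: "corner_label ?pr x (r - 1) = ?e \<longleftrightarrow> Suc x < c"
      using row.last_row_label(2)[of "Suc x"] lab[of x] x by simp
    have nz: "?e \<noteq> add_cell 0 ?e" using n by (auto simp: add_cell_eq_iff empty_partition_def)
    have "weakly_covered ?e (corner_label ?pr x (r - 1))"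
      using corner_label_partition[OF n pr_tab, of x r] e x by simp
    moreover have "is_partition n (corner_label ?pr x (r - 1))"
      using corner_label_partition[OF n pr_tab, of x "r - 1"] x by simp
    ultimately have "corner_label ?pr x (r - 1) = ?e \<or> corner_label ?pr x (r - 1) = add_cell 0 ?e"
      using covered_empty unfolding weakly_covered_def by metis
    then show ?thesis
      using e kap mu nz by (auto simp: cell_cross_def has_cross_def)
  qed
  have first: "cell_cross \<omega> 1 b \<longleftrightarrow> b = c" if "1 < b" "b \<le> r" for b
    using row.cell_cross_first_column[of b] that by simp
  show ?thesis
  proof (intro equalityI subsetI)
    fix p assume "p \<in> rotate_matching r (sundaram r ?pr)"
    then obtain i j where ij: "1 \<le> i" "i < j" "j \<le> r" "cell_cross ?pr i j"
      and p: "p = {i mod r + 1, j mod r + 1}"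
      by (auto simp: rotate_matching_def sundaram_def)
    show "p \<in> sundaram r \<omega>"
    proof (cases "j = r")
      case True
      then have ic: "Suc i = c" "p = {1, c}" using outer ij p by auto
      moreover have "cell_cross \<omega> 1 c" using first[of c] cr ic ij by simp
      moreover have "1 < c" using ic ij by simp
      ultimately show ?thesis unfolding sundaram_def using cr by blast
    next
      case False
      then have "p = {Suc i, Suc j}" "cell_cross \<omega> (Suc i) (Suc j)" using inner ij p by auto
      moreover have "1 \<le> Suc i" "Suc i < Suc j" "Suc j \<le> r" using False ij by auto
      ultimately show ?thesis unfolding sundaram_def by blast
    qed
  next
    fix p assume "p \<in> sundaram r \<omega>"
    then obtain i j where ij: "1 \<le> i" "i < j" "j \<le> r" "cell_cross \<omega> i j" and p: "p = {i, j}"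
      by (auto simp: sundaram_def)
    have "\<exists>i' j'. 1 \<le> i' \<and> i' < j' \<and> j' \<le> r \<and> cell_cross ?pr i' j' \<and> p = {i' mod r + 1, j' mod r + 1}"
    proof (cases "i = 1")
      case True
      then have "j = c" using first ij by simp
      then have "cell_cross ?pr (j - 1) r" "p = {(j - 1) mod r + 1, r mod r + 1}"
        using outer[of "j - 1"] True ij p by auto
      moreover have "1 \<le> j - 1" "j - 1 < r" "r \<le> r" using True ij by auto
      ultimately show ?thesis by blast
    next
      case False
      then have "cell_cross ?pr (i - 1) (j - 1)" using inner[of "i - 1" "j - 1"] ij by simp
      moreover have "1 \<le> i - 1" "i - 1 < j - 1" "j - 1 \<le> r" using False ij by auto
      moreover have "p = {(i - 1) mod r + 1, (j - 1) mod r + 1}" using ij p by simp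
      ultimately show ?thesis by blast
    qed
    then obtain i' j' where "1 \<le> i'" "i' < j'" "j' \<le> r" "cell_cross ?pr i' j'"
      "p = (\<lambda>i. i mod r + 1) ` {i', j'}" by auto
    then show "p \<in> rotate_matching r (sundaram r ?pr)"
      unfolding rotate_matching_def sundaram_def by blast
  qed
qed

theorem theorem3p3:
  fixes n r :: nat and \<omega> :: "int list list"
  assumes "n \<ge> 1"
    and "osc_tableau n r (empty_partition n) \<omega>"
  shows "rotate_matching r (sundaram r (promotion n r \<omega>)) = sundaram r \<omega>
    \<and> reverse_matching r (sundaram r \<omega>) = sundaram r (evacuation n r \<omega>)"
proof (cases "r = 0")
  case True
  then show ?thesis
    using reverse_matching_evacuation[OF assms] by (simp add: sundaram_def rotate_matching_def)
next
  case False
  then show ?thesis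
    using reverse_matching_evacuation[OF assms] rotate_matching_promotion[OF assms] by simp
qed

end
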